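(* Let $d\ge2$, let $(B_t)_{0\le t\le1}$ be $d$-dimensional Brownian motion started at $0$, and let $\mu$ be its occupation measure, $\mu(\Lambda)=\int_0^1\mathbf 1_\Lambda(B_t)\,dt$ for Borel $\Lambda\subset\mathbf R^d$. With probability one, there exists a finite constant $C=C(\omega)$ (not depending on $f$) such that for all kernels $f$, $$\mathcal E_f(\mu)\;\le\;C\int_0^1 r f(r)\,dr\quad\text{if } d\ge3,\qquad \mathcal E_f(\mu)\;\le\;C\int_0^1 r\log\tfrac1r\, f(r)\,dr\quad\text{if } d=2.$$
   Context: A kernel is a weakly decreasing function $f:[0,\infty)\to[0,\infty]$ such that $\lim_{r\downarrow0}f(r)=f(0)$ if this limit is finite. For a Borel measure $\nu$ on $\mathbf R^d$, the energy is $\mathcal E_f(\nu)=\int_{\mathbf R^d}\int_{\mathbf R^d}f(|x-y|)\,d\nu(x)\,d\nu(y)$, with $|\cdot|$ the Euclidean norm. *)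

theory Defs
  imports "HOL-Probability.Probability"
begin

text \<open>Density of the \<open>d\<close>-dimensional Gaussian law with mean \<open>0\<close> and covariance matrix \<open>v I\<close>
  (the library's \<^const>\<open>normal_density\<close> takes the standard deviation).\<close>

definition gaussian_density :: "real \<Rightarrow> real ^ 'n \<Rightarrow> real" where
  "gaussian_density v x = (\<Prod>i\<in>UNIV. normal_density 0 (sqrt v) (x $ i))"

text \<open>Brownian motion on the time interval \<open>[0, 1]\<close>; \<open>B t\<close> is unconstrained for other \<open>t\<close>.
  The starting point and path continuity are only required almost surely.\<close>

locale brownian_motion = prob_space M
  for M :: "'w measure" and B :: "real \<Rightarrow> 'w \<Rightarrow> real ^ 'n" +
  assumes random_variable_B: "\<And>t. t \<in> {0..1} \<Longrightarrow> random_variable borel (B t)"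
    and start_zero: "AE \<omega> in M. B 0 \<omega> = 0"
    and independent_increments:
      "\<And>(n::nat) (t :: nat \<Rightarrow> real). mono_on {..n} t \<Longrightarrow> t ` {..n} \<subseteq> {0..1} \<Longrightarrow>
        indep_vars (\<lambda>_. borel) (\<lambda>i \<omega>. B (t (Suc i)) \<omega> - B (t i) \<omega>) {..<n}"
    and gaussian_increments:
      "\<And>s t. 0 \<le> s \<Longrightarrow> s < t \<Longrightarrow> t \<le> 1 \<Longrightarrow>
        distributed M lborel (\<lambda>\<omega>. B t \<omega> - B s \<omega>) (\<lambda>x. ennreal (gaussian_density (t - s) x))"
    and continuous_paths: "AE \<omega> in M. continuous_on {0..1} (\<lambda>t. B t \<omega>)"

definition occupation_measure :: "(real \<Rightarrow> real ^ 'n) \<Rightarrow> (real ^ 'n) measure" where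
  "occupation_measure X = distr (restrict_space lborel {0..1}) borel X"

lemma emeasure_occupation_measure:
  assumes "continuous_on {0..1} X" and "\<Lambda> \<in> sets borel"
  shows "emeasure (occupation_measure X) \<Lambda> = (\<integral>\<^sup>+t\<in>{0..1}. indicator \<Lambda> (X t) \<partial>lborel)"
proof -
  have X: "X \<in> measurable (restrict_space lborel {0..1}) borel"
    using borel_measurable_continuous_on_restrict[OF assms(1)]
    by (simp cong: measurable_cong_sets add: sets_restrict_space)
  have "emeasure (occupation_measure X) \<Lambda> =
      (\<integral>\<^sup>+x. indicator \<Lambda> x \<partial>distr (restrict_space lborel {0..1}) borel X)"
    using assms(2) by (simp add: occupation_measure_def)
  also have "\<dots> = (\<integral>\<^sup>+t. indicator \<Lambda> (X t) \<partial>restrict_space lborel {0..1})"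
    using X assms(2) by (subst nn_integral_distr) auto
  also have "\<dots> = (\<integral>\<^sup>+t\<in>{0..1}. indicator \<Lambda> (X t) \<partial>lborel)"
    by (subst nn_integral_restrict_space) auto
  finally show ?thesis .
qed

text \<open>Only the values of a kernel on \<open>[0, \<infinity>)\<close> are relevant. The limit at \<open>0\<close> exists in
  \<open>[0, \<infinity>]\<close> by monotonicity.\<close>

definition energy_kernel :: "(real \<Rightarrow> ennreal) \<Rightarrow> bool" where
  "energy_kernel f \<longleftrightarrow> antimono_on {0..} f \<and>
     (\<forall>L. (f \<longlongrightarrow> L) (at_right 0) \<and> L < \<infinity> \<longrightarrow> L = f 0)"

definition energy :: "(real \<Rightarrow> ennreal) \<Rightarrow> (real ^ 'n) measure \<Rightarrow> ennreal" where
  "energy f \<nu> = (\<integral>\<^sup>+y. (\<integral>\<^sup>+x. f (norm (x - y)) \<partial>\<nu>) \<partial>\<nu>)"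

end

theory Submission
  imports Defs
begin

text \<open>
  Let \<open>G(r)\<close> be the \<open>\<mu> \<times> \<mu>\<close>-mass of the pairs at distance at most \<open>r\<close>. Decomposing \<open>f\<close> along
  dyadic distances bounds the energy by \<open>\<Sum>\<^sub>k f(2\<^sup>-\<^sup>k\<^sup>-\<^sup>1) G(2\<^sup>-\<^sup>k)\<close> up to one more term, so it suffices that almost
  surely \<open>G(2\<^sup>-\<^sup>k) \<le> C 4\<^sup>-\<^sup>k\<close> for all \<open>k\<close> (with an extra factor \<open>k + 1\<close> in the plane). Split the pairs
  of times \<open>s < t\<close> dyadically into squares on which \<open>s\<close> and \<open>t\<close> range over two adjacent
  intervals of length \<open>2\<^sup>-\<^sup>j\<close>, \<open>j \<le> 2k\<close>; the remaining pairs have total measure \<open>4\<^sup>-\<^sup>k\<close>. Within one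
  scale \<open>j\<close> the squares contribute uncorrelated amounts, whose second moments are controlled by the
  independence of three consecutive increments; across scales the standard deviations add up. Means
  are of the right order, and the variances divided by the squared target are summable in \<open>k\<close>, so the
  deviations are almost surely bounded uniformly in \<open>k\<close>. Dimensions above \<open>3\<close> are treated as dimension \<open>3\<close>
  by discarding coordinates.
\<close>

subsection \<open>Small balls and Brownian increments\<close>

text \<open>Bounding the mean of \<open>G(2^-k)\<close> is not enough: one constant must serve all
  k, and Markov's inequality gives estimates that cannot be summed over k. Hence the second moments,
  in which two pairs of times interact. If times are measured from the common endpoint of the two
  adjacent intervals, geometric means turn the joint estimate into a function of the two times
  before that endpoint, multiplied by a function of the two times after it, so every moment reduces
  to the one-dimensional integral of \<open>weight\<close>. This weight behaves like
  \<open>u powr (- m / 4)\<close> and is integrable at 0 only for m < 4, which is why at most three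
  coordinates are kept. The time cutoff 4^-k is the square of the radius 2^-k: over shorter times
  the path has typically not moved beyond the radius, so little is lost by counting all remaining
  pairs. Only the countably many numbers G(2^-k) are random; whatever involves f is deterministic,
  which makes C and the exceptional set independent of f.\<close>

lemma nn_integral_lborel_vec_prod:
  fixes f :: "'n::finite \<Rightarrow> real \<Rightarrow> ennreal"
  assumes [measurable]: "\<And>i. f i \<in> borel_measurable borel"
  shows "(\<integral>\<^sup>+x. (\<Prod>i\<in>UNIV. f i (x $ i)) \<partial>lborel) = (\<Prod>i\<in>UNIV. \<integral>\<^sup>+u. f i u \<partial>lborel)"
proof -
  define g :: "real ^ 'n \<Rightarrow> real \<Rightarrow> ennreal" where "g b = f (axis_index b)" for b
  have Basis: "(Basis :: (real ^ 'n) set) = range (\<lambda>i. axis i 1)"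
    by (auto simp: Basis_vec_def)
  have inj: "inj (\<lambda>i. axis i 1 :: real ^ 'n)"
    by (auto simp: inj_def axis_eq_axis)
  have g: "g (axis i 1) = f i" for i
    by (simp add: g_def axis_index_def axis_eq_axis)
  have "(\<integral>\<^sup>+x. (\<Prod>b\<in>Basis. g b (x \<bullet> b)) \<partial>lborel) = (\<Prod>b\<in>Basis. \<integral>\<^sup>+u. g b u \<partial>lborel)"
    by (intro nn_integral_lborel_prod) (auto simp: g_def)
  then show ?thesis
    by (simp add: Basis prod.reindex[OF inj] g inner_axis)
qed

text \<open>The density is at most \<open>1 / (2 * \<sigma>)\<close> because sqrt (2 pi) >= 2. This
  rounding cancels the length 2r of the interval and keeps the later ball bounds free of
  constants.\<close>

lemma nn_integral_normal_density_le:
  assumes "0 < \<sigma>" "0 \<le> r"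
  shows "(\<integral>\<^sup>+u. ennreal (normal_density 0 \<sigma> u) * indicator {a - r..a + r} u \<partial>lborel) \<le> ennreal (r / \<sigma>)"
proof -
  have *: "normal_density 0 \<sigma> u \<le> 1 / (2 * \<sigma>)" for u
  proof -
    have "2 \<le> sqrt (2 * pi)"
      using pi_ge_two by (intro real_le_rsqrt) auto
    then have "2 * \<sigma> \<le> sqrt (2 * pi * \<sigma>\<^sup>2)"
      using assms by (simp add: real_sqrt_mult)
    then have "1 / sqrt (2 * pi * \<sigma>\<^sup>2) \<le> 1 / (2 * \<sigma>)"
      using assms by (intro divide_left_mono) auto
    moreover have "exp (- (u - 0)\<^sup>2 / (2 * \<sigma>\<^sup>2)) \<le> 1"
      by simp
    ultimately show ?thesis
      unfolding normal_density_def
      by (metis (no_types, lifting) exp_ge_zero mult.right_neutral mult_mono zero_le_one 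
          real_sqrt_ge_zero divide_nonneg_nonneg assms(1) less_imp_le mult_nonneg_nonneg zero_le_numeral)
  qed
  have "(\<integral>\<^sup>+u. ennreal (normal_density 0 \<sigma> u) * indicator {a - r..a + r} u \<partial>lborel)
      \<le> (\<integral>\<^sup>+u. ennreal (1 / (2 * \<sigma>)) * indicator {a - r..a + r} u \<partial>lborel)"
    using * by (intro nn_integral_mono mult_right_mono ennreal_leI) auto
  also have "\<dots> = ennreal (r / \<sigma>)"
    using assms by (simp add: nn_integral_cmult_indicator ennreal_mult' [symmetric])
  finally show ?thesis .
qed

text \<open>The ball lies in the cylinder that restricts only the coordinates in \<open>S\<close>;
  the other factors integrate to 1. The free choice of \<open>S\<close> later lowers the exponent to
  2 or 3 in any larger dimension.\<close>

lemma gaussian_density_ball_le: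
  fixes x :: "real ^ 'n"
  assumes "0 < v" "0 \<le> r"
  shows "(\<integral>\<^sup>+y. ennreal (gaussian_density v y) * indicator {y. norm (y - x) \<le> r} y \<partial>lborel)
    \<le> ennreal ((r / sqrt v) ^ card (S :: 'n set))"
proof -
  define g where "g i u = ennreal (normal_density 0 (sqrt v) u) *
      (if i \<in> S then indicator {x $ i - r..x $ i + r} u else 1)" for i u
  have "(\<integral>\<^sup>+y. ennreal (gaussian_density v y) * indicator {y. norm (y - x) \<le> r} y \<partial>lborel)
      \<le> (\<integral>\<^sup>+y. (\<Prod>i\<in>UNIV. g i (y $ i)) \<partial>lborel)"
  proof (intro nn_integral_mono)
    fix y :: "real ^ 'n"
    show "ennreal (gaussian_density v y) * indicator {y. norm (y - x) \<le> r} y \<le> (\<Prod>i\<in>UNIV. g i (y $ i))"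
    proof (cases "norm (y - x) \<le> r")
      case True
      have "y $ i \<in> {x $ i - r..x $ i + r}" for i
        using component_le_norm_cart[of "y - x" i] True by (simp add: abs_le_iff)
      then have "g i (y $ i) = ennreal (normal_density 0 (sqrt v) (y $ i))" for i
        by (simp add: g_def)
      then show ?thesis
        by (simp add: gaussian_density_def prod_ennreal indicator_def)
    qed simp
  qed
  also have "\<dots> = (\<Prod>i\<in>UNIV. \<integral>\<^sup>+u. g i u \<partial>lborel)"
    by (intro nn_integral_lborel_vec_prod) (simp add: g_def)
  also have "\<dots> \<le> (\<Prod>i\<in>UNIV. if i \<in> S then ennreal (r / sqrt v) else 1)"
  proof (intro prod_mono_ennreal)
    fix i
    show "(\<integral>\<^sup>+u. g i u \<partial>lborel) \<le> (if i \<in> S then ennreal (r / sqrt v) else 1)"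
    proof (cases "i \<in> S")
      case True
      then show ?thesis
        using nn_integral_normal_density_le[of "sqrt v" r "x $ i"] assms by (simp add: g_def)
    next
      case False
      interpret prob_space "density lborel (normal_density 0 (sqrt v))"
        using assms by (intro prob_space_normal_density) auto
      show ?thesis
        using False emeasure_space_1 by (simp add: g_def emeasure_density)
    qed
  qed
  also have "\<dots> = ennreal ((r / sqrt v) ^ card S)"
    using assms by (simp add: prod.If_cases ennreal_power)
  finally show ?thesis .
qed

text \<open>The centre \<open>x\<close> is arbitrary because conditioning on other increments shifts
  the ball.\<close>

lemma (in brownian_motion) increment_ball_le:
  assumes "0 \<le> s" "s < t" "t \<le> 1" "0 \<le> r"
  shows "prob {\<omega> \<in> space M. norm (B t \<omega> - B s \<omega> - x) \<le> r} \<le> (r / sqrt (t - s)) ^ card (S :: 'n set)"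
proof -
  have "ennreal (prob {\<omega> \<in> space M. norm (B t \<omega> - B s \<omega> - x) \<le> r}) =
    emeasure M ((\<lambda>\<omega>. B t \<omega> - B s \<omega>) -` {y. norm (y - x) \<le> r} \<inter> space M)"
    by (auto simp: emeasure_eq_measure intro!: arg_cong[where f=prob])
  also have "\<dots> = (\<integral>\<^sup>+y. ennreal (gaussian_density (t - s) y) * indicator {y. norm (y - x) \<le> r} y \<partial>lborel)"
    using assms by (intro distributed_emeasure[OF gaussian_increments]) auto
  also have "\<dots> \<le> ennreal ((r / sqrt (t - s)) ^ card S)"
    using assms by (intro gaussian_density_ball_le) auto
  finally show ?thesis
    using assms by simp
qed

text \<open>By independence the joint law is a product, and for a fixed value of \<open>X\<close>
  the ball has a deterministic centre. The event \<open>A\<close> allows the estimate to be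
  iterated; \<open>v\<close> picks one vector out of a family of increments.\<close>

lemma (in prob_space) indep_var_ball_le:
  fixes v :: "'b \<Rightarrow> 'c::euclidean_space"
  assumes indep: "indep_var N X K Y" and v[measurable]: "v \<in> borel_measurable K"
    and A[measurable]: "A \<in> sets N" and g[measurable]: "g \<in> borel_measurable N"
    and q: "\<And>x. prob {\<omega> \<in> space M. norm (v (Y \<omega>) - x) \<le> r} \<le> q"
  shows "prob {\<omega> \<in> space M. X \<omega> \<in> A \<and> norm (v (Y \<omega>) - g (X \<omega>)) \<le> r} \<le> prob {\<omega> \<in> space M. X \<omega> \<in> A} * q"
proof -
  have X[measurable]: "X \<in> measurable M N" and Y[measurable]: "Y \<in> measurable M K"
    using indep by (auto dest: indep_var_rv1 indep_var_rv2)
  have q0: "0 \<le> q"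
    using q[of 0] measure_nonneg[of M] by (meson order_trans)
  interpret Y: prob_space "distr M K Y"
    by (rule prob_space_distr) simp
  define E where "E = {p \<in> space (N \<Otimes>\<^sub>M K). fst p \<in> A \<and> norm (v (snd p) - g (fst p)) \<le> r}"
  have E[measurable]: "E \<in> sets (N \<Otimes>\<^sub>M K)"
    unfolding E_def by measurable
  have sp: "X \<omega> \<in> space N" if "\<omega> \<in> space M" for \<omega>
    using measurable_space[OF X that] .
  have spY: "Y \<omega> \<in> space K" if "\<omega> \<in> space M" for \<omega>
    using measurable_space[OF Y that] .
  have "ennreal (prob {\<omega> \<in> space M. X \<omega> \<in> A \<and> norm (v (Y \<omega>) - g (X \<omega>)) \<le> r}) =
     emeasure (distr M (N \<Otimes>\<^sub>M K) (\<lambda>\<omega>. (X \<omega>, Y \<omega>))) E"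
    by (subst emeasure_distr)
       (auto simp: E_def emeasure_eq_measure space_pair_measure sp spY intro!: arg_cong[where f=prob])
  also have "\<dots> = emeasure (distr M N X \<Otimes>\<^sub>M distr M K Y) E"
    using indep by (simp add: indep_var_distribution_eq)
  also have "\<dots> = (\<integral>\<^sup>+x. emeasure (distr M K Y) (Pair x -` E) \<partial>distr M N X)"
    by (intro Y.emeasure_pair_measure_alt) simp
  also have "\<dots> \<le> (\<integral>\<^sup>+x. ennreal q * indicator A x \<partial>distr M N X)"
  proof (intro nn_integral_mono)
    fix x assume x: "x \<in> space (distr M N X)"
    show "emeasure (distr M K Y) (Pair x -` E) \<le> ennreal q * indicator A x"
    proof (cases "x \<in> A")
      case True
      have "Pair x -` E = {y \<in> space K. norm (v y - g x) \<le> r}"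
        using True x by (auto simp: E_def space_pair_measure)
      moreover have "Y -` {y \<in> space K. norm (v y - g x) \<le> r} \<inter> space M = {\<omega> \<in> space M. norm (v (Y \<omega>) - g x) \<le> r}"
        using spY by auto
      ultimately show ?thesis
        using True q[of "g x"] by (simp add: emeasure_distr emeasure_eq_measure ennreal_leI)
    next
      case False
      then have "Pair x -` E = {}"
        by (auto simp: E_def)
      then show ?thesis by simp
    qed
  qed
  also have "\<dots> = ennreal q * emeasure M (X -` A \<inter> space M)"
    by (subst nn_integral_cmult_indicator) (auto simp: emeasure_distr)
  also have "X -` A \<inter> space M = {\<omega> \<in> space M. X \<omega> \<in> A}"
    by auto
  finally show ?thesis
    using q0 by (simp add: emeasure_eq_measure mult.commute flip: ennreal_mult)
qed

text \<open>The previous lemma is used twice: \<open>I k\<close> is estimated given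
  \<open>I i\<close> and \<open>I j\<close>, then \<open>I j\<close> given \<open>I i\<close>. The
  increment \<open>I i\<close> is not estimated and only moves the centres.\<close>

lemma (in prob_space) indep_vars_two_balls_le:
  fixes I :: "nat \<Rightarrow> 'a \<Rightarrow> 'c::euclidean_space"
  assumes indep: "indep_vars (\<lambda>_. borel) I L" and L: "i \<in> L" "j \<in> L" "k \<in> L" "i \<noteq> j" "j \<noteq> k" "i \<noteq> k"
    and g[measurable]: "g \<in> borel_measurable borel" 
    and h[measurable]: "case_prod h \<in> borel_measurable (borel \<Otimes>\<^sub>M borel)"
    and q1: "\<And>x. prob {\<omega> \<in> space M. norm (I j \<omega> - x) \<le> r} \<le> q1"
    and q2: "\<And>x. prob {\<omega> \<in> space M. norm (I k \<omega> - x) \<le> r} \<le> q2"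
  shows "prob {\<omega> \<in> space M. norm (I j \<omega> - g (I i \<omega>)) \<le> r \<and> norm (I k \<omega> - h (I i \<omega>) (I j \<omega>)) \<le> r} \<le> q1 * q2"
proof -
  have rv[measurable]: "I i \<in> borel_measurable M" "I j \<in> borel_measurable M" "I k \<in> borel_measurable M"
    using indep L by (auto simp: indep_vars_def)
  have "0 \<le> q2"
    using q2[of 0] measure_nonneg[of M] by (meson order_trans)
  define X where "X J \<omega> = (\<lambda>l\<in>J. I l \<omega>)" for J \<omega>
  have ij: "indep_var (PiM {i} (\<lambda>_. borel)) (X {i}) (PiM {j} (\<lambda>_. borel)) (X {j})"
    unfolding X_def using L by (intro indep_var_restrict[OF indep]) auto
  have ijk: "indep_var (PiM {i, j} (\<lambda>_. borel)) (X {i, j}) (PiM {k} (\<lambda>_. borel)) (X {k})"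
    unfolding X_def using L by (intro indep_var_restrict[OF indep]) auto
  define A where "A = {p \<in> space (PiM {i, j} (\<lambda>_. borel :: 'c measure)). norm (p j - g (p i)) \<le> r}"
  have A: "A \<in> sets (PiM {i, j} (\<lambda>_. borel))"
    unfolding A_def by measurable
  have "prob {\<omega> \<in> space M. norm (I j \<omega> - g (I i \<omega>)) \<le> r \<and> norm (I k \<omega> - h (I i \<omega>) (I j \<omega>)) \<le> r}
    \<le> prob {\<omega> \<in> space M. norm (I j \<omega> - g (I i \<omega>)) \<le> r} * q2"
    using indep_var_ball_le[OF ijk _ A, of "\<lambda>f. f k" "\<lambda>f. h (f i) (f j)" r q2] q2
    by (simp add: A_def X_def space_PiM)
  \<comment> \<open>Here the event on the conditioning variable is the whole space, of probability
    1.\<close>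
  also have "prob {\<omega> \<in> space M. norm (I j \<omega> - g (I i \<omega>)) \<le> r} \<le> q1"
    using indep_var_ball_le[OF ij, of "\<lambda>f. f j" "space (PiM {i} (\<lambda>_. borel))" "\<lambda>f. g (f i)" r q1] q1
    by (simp add: prob_space X_def space_PiM)
  finally show ?thesis
    using \<open>0 \<le> q2\<close> by (simp add: mult_right_mono)
qed

text \<open>The square root of the bound for the probability of finding a Brownian increment over a time
  \<open>u\<close> in a ball of radius \<open>r\<close>, projected to \<open>m\<close> coordinates. The value \<open>\<infinity>\<close> at \<open>0\<close> makes the bounds below
  valid for coinciding times.\<close>

definition weight :: "nat \<Rightarrow> real \<Rightarrow> real \<Rightarrow> ennreal" where
  "weight m r u = (if 0 < u then ennreal (sqrt ((r / sqrt u) ^ m)) else \<infinity>)"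

lemma weight_pos: "0 < r \<Longrightarrow> 0 < weight m r u"
  by (simp add: weight_def)

lemma weight_antimono: "0 < r \<Longrightarrow> u \<le> v \<Longrightarrow> weight m r v \<le> weight m r u"
  by (auto simp: weight_def intro!: ennreal_leI real_sqrt_le_mono power_mono divide_left_mono)

lemma le_sqrt_mult_sqrt:
  fixes p x y :: real
  assumes "0 \<le> p" "p \<le> x" "p \<le> y"
  shows "p \<le> sqrt x * sqrt y"
proof -
  have "p * p \<le> x * y"
    using assms by (intro mult_mono) auto
  then show ?thesis
    using assms by (simp add: real_le_rsqrt power2_eq_square flip: real_sqrt_mult)
qed

section \<open>Joint small ball estimates for two pairs of times\<close>

context brownian_motion
begin

text \<open>Conditioning on the first or on the last of the three increments bounds both probabilities by
  the product of the ball bounds of the two others; \<open>R\<close> is the geometric mean of these two products.\<close>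

lemma two_pairs_ball_le:
  fixes S :: "'n set"
  assumes t: "0 \<le> t0" "t0 < t1" "t1 < t2" "t2 < t3" "t3 \<le> 1" and r: "0 < r"
  defines "R \<equiv> (r / sqrt (t2 - t1)) ^ card S *
    (sqrt ((r / sqrt (t1 - t0)) ^ card S) * sqrt ((r / sqrt (t3 - t2)) ^ card S))"
  shows nested_ball_le: "prob {\<omega> \<in> space M. norm (B t2 \<omega> - B t1 \<omega>) \<le> r \<and> norm (B t3 \<omega> - B t0 \<omega>) \<le> r} \<le> R" (is "prob ?N \<le> _")
    and interlaced_ball_le: "prob {\<omega> \<in> space M. norm (B t2 \<omega> - B t0 \<omega>) \<le> r \<and> norm (B t3 \<omega> - B t1 \<omega>) \<le> r} \<le> R" (is "prob ?I \<le> _")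
proof -
  define t where "t i = (if i = 0 then t0 else if i = 1 then t1 else if i = 2 then t2 else t3)" for i :: nat
  define I where "I i \<omega> = B (t (Suc i)) \<omega> - B (t i) \<omega>" for i \<omega>
  define q where "q u = (r / sqrt u) ^ card S" for u
  have indep: "indep_vars (\<lambda>_. borel) I {..<3}"
    unfolding I_def[abs_def] using t
    by (intro independent_increments) (auto simp: mono_on_def t_def)
  have I: "I 0 = (\<lambda>\<omega>. B t1 \<omega> - B t0 \<omega>)" "I (Suc 0) = (\<lambda>\<omega>. B t2 \<omega> - B t1 \<omega>)" "I 2 = (\<lambda>\<omega>. B t3 \<omega> - B t2 \<omega>)"
    by (auto simp: I_def t_def fun_eq_iff)
  have q: "prob {\<omega> \<in> space M. norm (I 0 \<omega> - x) \<le> r} \<le> q (t1 - t0)"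
     "prob {\<omega> \<in> space M. norm (I (Suc 0) \<omega> - x) \<le> r} \<le> q (t2 - t1)"
     "prob {\<omega> \<in> space M. norm (I 2 \<omega> - x) \<le> r} \<le> q (t3 - t2)" for x
    unfolding I q_def using t r by (auto intro!: increment_ball_le)
  have pos: "0 < q (t1 - t0)" "0 < q (t2 - t1)" "0 < q (t3 - t2)"
    using t r by (auto simp: q_def)
  have combine: "prob E \<le> R" if "prob E \<le> q (t2 - t1) * q (t3 - t2)" "prob E \<le> q (t2 - t1) * q (t1 - t0)" for E
  proof -
    have "prob E / q (t2 - t1) \<le> sqrt (q (t1 - t0)) * sqrt (q (t3 - t2))"
      using that pos by (intro le_sqrt_mult_sqrt) (auto simp: field_simps)
    then show ?thesis
      using pos unfolding R_def q_def[symmetric] by (simp add: field_simps)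
  qed
  note two = indep_vars_two_balls_le[OF indep, where r=r]
  \<comment> \<open>Nested pairs: \<open>I 1\<close> is near 0 and \<open>I 0 + I 1 + I 2\<close> is
    near 0, so given the first two increments the third is near minus their sum. Exchanging the
    first and the last increment gives the second bound.\<close>
  have "prob ?N \<le> q (t2 - t1) * q (t3 - t2)"
    using two[of 0 "Suc 0" 2 "\<lambda>_. 0" "\<lambda>x y. - x - y", OF _ _ _ _ _ _ _ _ q(2,3)]
    by (simp add: I algebra_simps)
  moreover have "prob ?N \<le> q (t2 - t1) * q (t1 - t0)"
    using two[of 2 "Suc 0" 0 "\<lambda>_. 0" "\<lambda>x y. - x - y", OF _ _ _ _ _ _ _ _ q(2,1)]
    by (simp add: I algebra_simps)
  ultimately show "prob ?N \<le> R"
    by (rule combine)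
  \<comment> \<open>Interlaced pairs: \<open>I 0 + I 1\<close> and \<open>I 1 + I 2\<close> are near
    0, so the centres are \<open>- I 0\<close> for \<open>I 1\<close> and \<open>- I 1\<close> for
    \<open>I 2\<close>.\<close>
  have "prob ?I \<le> q (t2 - t1) * q (t3 - t2)"
    using two[of 0 "Suc 0" 2 "\<lambda>x. - x" "\<lambda>x y. - y", OF _ _ _ _ _ _ _ _ q(2,3)]
    by (simp add: I algebra_simps)
  moreover have "prob ?I \<le> q (t2 - t1) * q (t1 - t0)"
    using two[of 2 "Suc 0" 0 "\<lambda>x. - x" "\<lambda>x y. - y", OF _ _ _ _ _ _ _ _ q(2,1)]
    by (simp add: I algebra_simps conj_commute)
  ultimately show "prob ?I \<le> R"
    by (rule combine)
qed

text \<open>Weak inequalities matter, since adjacent dyadic intervals share an endpoint. The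
  increment between the two pairs is left out by using the index set \<open>{0, 2}\<close>.\<close>

lemma disjoint_pairs_ball_eq:
  assumes t: "0 \<le> t0" "t0 \<le> t1" "t1 \<le> t2" "t2 \<le> t3" "t3 \<le> 1"
  shows "prob {\<omega> \<in> space M. norm (B t1 \<omega> - B t0 \<omega>) \<le> r \<and> norm (B t3 \<omega> - B t2 \<omega>) \<le> r} =
    prob {\<omega> \<in> space M. norm (B t1 \<omega> - B t0 \<omega>) \<le> r} * prob {\<omega> \<in> space M. norm (B t3 \<omega> - B t2 \<omega>) \<le> r}"
proof -
  define t where "t i = (if i = 0 then t0 else if i = 1 then t1 else if i = 2 then t2 else t3)" for i :: nat
  define I where "I i \<omega> = B (t (Suc i)) \<omega> - B (t i) \<omega>" for i \<omega>
  have indep: "indep_vars (\<lambda>_. borel) I {..<3}"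
    unfolding I_def[abs_def] using t
    by (intro independent_increments) (auto simp: mono_on_def t_def)
  have I: "I 0 = (\<lambda>\<omega>. B t1 \<omega> - B t0 \<omega>)" "I 2 = (\<lambda>\<omega>. B t3 \<omega> - B t2 \<omega>)"
    by (auto simp: I_def t_def fun_eq_iff)
  have "prob (\<Inter>i\<in>{0, 2}. I i -` {x. norm x \<le> r} \<inter> space M) = (\<Prod>i\<in>{0, 2}. prob (I i -` {x. norm x \<le> r} \<inter> space M))"
    by (intro indep_varsD[OF indep]) auto
  also have "(\<Inter>i\<in>{0, 2}. I i -` {x. norm x \<le> r} \<inter> space M) =
      {\<omega> \<in> space M. norm (B t1 \<omega> - B t0 \<omega>) \<le> r \<and> norm (B t3 \<omega> - B t2 \<omega>) \<le> r}"
    by (auto simp: I)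
  also have "(\<Prod>i\<in>{0, 2}. prob (I i -` {x. norm x \<le> r} \<inter> space M)) =
      prob {\<omega> \<in> space M. norm (B t1 \<omega> - B t0 \<omega>) \<le> r} * prob {\<omega> \<in> space M. norm (B t3 \<omega> - B t2 \<omega>) \<le> r}"
    by (simp add: I vimage_def Int_def conj_commute)
  finally show ?thesis .
qed

text \<open>The elapsed time \<open>a + b\<close> is at least \<open>a\<close> and at least
  \<open>b\<close>; splitting the bound into two square roots gives one factor for each side of
  \<open>c\<close>.\<close>

lemma crossing_ball_le:
  assumes r: "0 < r" and c: "0 \<le> a" "0 \<le> b" "0 \<le> c - a" "c + b \<le> 1"
  shows "emeasure M {\<omega> \<in> space M. norm (B (c + b) \<omega> - B (c - a) \<omega>) \<le> r}
    \<le> weight (card (S :: 'n set)) r a * weight (card S) r b"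
proof (cases "a = 0 \<or> b = 0")
  case True
  then have "weight (card S) r a * weight (card S) r b = \<infinity>"
    using weight_pos[OF r, of "card S" a] weight_pos[OF r, of "card S" b]
    by (auto simp: weight_def ennreal_mult_top ennreal_top_mult)
  then show ?thesis by simp
next
  case False
  with c have ab: "0 < a" "0 < b" by auto
  have "prob {\<omega> \<in> space M. norm (B (c + b) \<omega> - B (c - a) \<omega>) \<le> r} \<le> (r / sqrt (a + b)) ^ card S"
    using increment_ball_le[of "c - a" "c + b" r 0 S] c ab r by (simp add: algebra_simps)
  also have "\<dots> = sqrt ((r / sqrt (a + b)) ^ card S) * sqrt ((r / sqrt (a + b)) ^ card S)"
    using ab r by simp
  also have "\<dots> \<le> sqrt ((r / sqrt a) ^ card S) * sqrt ((r / sqrt b) ^ card S)"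
    using ab r by (intro mult_mono real_sqrt_le_mono power_mono divide_left_mono) auto
  finally show ?thesis
    using ab r by (simp add: weight_def emeasure_eq_measure flip: ennreal_mult)
qed

text \<open>Both pairs straddle \<open>c\<close>, so they are nested or interlaced, never disjoint.
  The middle one of the three increments lasts \<open>min a a' + min b b'\<close>, the outer ones
  \<open>\<bar>a - a'\<bar>\<close> and \<open>\<bar>b - b'\<bar>\<close>.\<close>

lemma two_crossings_ball_le:
  fixes S :: "'n set"
  defines "\<phi> r \<equiv> weight (card S) r"
  assumes r: "0 < r" and c: "0 \<le> a" "0 \<le> b" "0 \<le> c - a" "c + b \<le> 1"
    and c': "0 \<le> a'" "0 \<le> b'" "0 \<le> c - a'" "c + b' \<le> 1"
  shows "emeasure M {\<omega> \<in> space M. norm (B (c + b) \<omega> - B (c - a) \<omega>) \<le> r \<and> norm (B (c + b') \<omega> - B (c - a') \<omega>) \<le> r}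
    \<le> (\<phi> r (min a a') * \<phi> r \<bar>a - a'\<bar>) * (\<phi> r (min b b') * \<phi> r \<bar>b - b'\<bar>)"
  using c c'
proof (induction a a' arbitrary: b b' rule: linorder_wlog)
  case (sym a' a)
  then show ?case
    by (simp add: min.commute abs_minus_commute conj_commute)
next
  case (le a a')
  let ?E = "{\<omega> \<in> space M. norm (B (c + b) \<omega> - B (c - a) \<omega>) \<le> r \<and> norm (B (c + b') \<omega> - B (c - a') \<omega>) \<le> r}"
  have pos: "\<phi> r u \<noteq> 0" for u
    using weight_pos[OF r, of "card S" u] by (simp add: \<phi>_def)
  show ?case
  proof (cases "a = 0 \<or> a = a' \<or> b = 0 \<or> b' = 0 \<or> b = b'")
    case True
    \<comment> \<open>In every degenerate case some factor is the weight at 0 and all factors are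
      positive, so the product is infinite.\<close>
    have "\<phi> r 0 = \<infinity>"
      by (simp add: \<phi>_def weight_def)
    then have "(\<phi> r (min a a') * \<phi> r \<bar>a - a'\<bar>) * (\<phi> r (min b b') * \<phi> r \<bar>b - b'\<bar>) = \<infinity>"
      using True le pos by (auto simp: ennreal_mult_top ennreal_top_mult min_def)
    then show ?thesis by simp
  next
    case False
    define x y z where "x = a' - a" and "y = a + min b b'" and "z = \<bar>b - b'\<bar>"
    have xyz: "0 < x" "0 < y" "0 < z"
      using False le by (auto simp: x_def y_def z_def min_def)
    have "prob ?E \<le> (r / sqrt y) ^ card S * (sqrt ((r / sqrt x) ^ card S) * sqrt ((r / sqrt z) ^ card S))"
    proof (cases "b \<le> b'")
      case True
      then show ?thesis
        using nested_ball_le[of "c - a'" "c - a" "c + b" "c + b'" r S] r False le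
        by (simp add: x_def y_def z_def min_def algebra_simps)
    next
      case False': False
      then show ?thesis
        using interlaced_ball_le[of "c - a'" "c - a" "c + b'" "c + b" r S] r False le
        by (simp add: x_def y_def z_def min_def algebra_simps conj_commute)
    qed
    then have "emeasure M ?E \<le> (\<phi> r y * \<phi> r y) * (\<phi> r x * \<phi> r z)"
      using xyz r by (simp add: \<phi>_def weight_def emeasure_eq_measure flip: ennreal_mult)
    \<comment> \<open>The middle increment is the only one that mixes both sides of
      \<open>c\<close>. Its bound is the square of a weight, and each of the two weights is enlarged
      by keeping one side only.\<close>
    also have "\<dots> \<le> (\<phi> r a * \<phi> r (min b b')) * (\<phi> r x * \<phi> r z)"
      unfolding \<phi>_def using le r by (intro mult_mono weight_antimono) (auto simp: y_def)
    also have "\<dots> = (\<phi> r (min a a') * \<phi> r \<bar>a - a'\<bar>) * (\<phi> r (min b b') * \<phi> r \<bar>b - b'\<bar>)"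
      using le by (simp add: x_def z_def mult_ac)
    finally show ?thesis .
  qed
qed

end

subsection \<open>Moments of crossing times\<close>

text \<open>For u > 0 the weight is a multiple of \<open>u powr (- (m / 4))\<close>; the condition
  \<open>m < 4\<close> is its integrability at 0.\<close>

lemma nn_integral_weight:
  assumes "m < 4" "0 < r" "0 \<le> h"
  shows "(\<integral>\<^sup>+u\<in>{0..h}. weight m r u \<partial>lborel) = ennreal (sqrt (r ^ m) * (h powr (1 - m / 4) / (1 - m / 4)))"
proof -
  have *: "sqrt ((r / sqrt u) ^ m) = sqrt (r ^ m) * u powr (- (m / 4))" if "0 < u" for u
  proof -
    have "sqrt (sqrt u ^ m) = u powr (m / 4)"
      using that by (simp add: powr_powr flip: powr_half_sqrt powr_realpow)
    then show ?thesis
      using that assms by (simp add: power_divide real_sqrt_divide powr_minus_divide)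
  qed
  have "AE u in lborel. weight m r u * indicator {0..h} u =
      ennreal (sqrt (r ^ m) * (if u \<in> {0..h} then u powr (- (m / 4)) else 0))"
    using AE_lborel_singleton[of "0::real"]
  proof eventually_elim
    case (elim u)
    show ?case
    proof (cases "u \<in> {0..h}")
      case True
      with elim have "0 < u" by auto
      with True show ?thesis by (simp add: weight_def *)
    next
      case False
      then show ?thesis by auto
    qed
  qed
  then have "(\<integral>\<^sup>+u\<in>{0..h}. weight m r u \<partial>lborel) =
      (\<integral>\<^sup>+u. ennreal (sqrt (r ^ m) * (if u \<in> {0..h} then u powr (- (m / 4)) else 0)) \<partial>lborel)"
    by (rule nn_integral_cong_AE)
  also have "\<dots> = ennreal (sqrt (r ^ m) * (h powr (- (m / 4) + 1) / (- (m / 4) + 1)))"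
    using has_integral_powr_from_0[of "- (m / 4)" h] assms
    by (intro nn_integral_has_integral_lborel has_integral_mult_right has_integral_restrict_UNIV[THEN iffD2]) auto
  finally show ?thesis
    by (simp add: algebra_simps)
qed

lemma borel_measurable_weight[measurable]: "weight m r \<in> borel_measurable borel"
  unfolding weight_def[abs_def] by measurable

text \<open>On each side of the diagonal, the smaller variable and the difference both range within
  [0, h], and translation invariance separates them. The factor 2 counts the two orders.\<close>

lemma nn_integral_weight_convolution_le:
  fixes m :: nat and r h :: real
  defines "\<phi> u \<equiv> weight m r u * indicator {0..h} u"
  shows "(\<integral>\<^sup>+a. \<integral>\<^sup>+a'. (weight m r (min a a') * weight m r \<bar>a - a'\<bar>) * indicator ({0..h} \<times> {0..h}) (a, a') \<partial>lborel \<partial>lborel)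
    \<le> 2 * (\<integral>\<^sup>+u. \<phi> u \<partial>lborel)\<^sup>2"
proof -
  have [measurable]: "\<phi> \<in> borel_measurable borel"
    unfolding \<phi>_def[abs_def] by measurable
  have shift: "(\<integral>\<^sup>+x. \<phi> (x - a) \<partial>lborel) = (\<integral>\<^sup>+x. \<phi> x \<partial>lborel)" for a
    using nn_integral_real_affine[of "\<lambda>x. \<phi> (x - a)" 1 a] by simp
  have "(\<integral>\<^sup>+a. \<integral>\<^sup>+a'. (weight m r (min a a') * weight m r \<bar>a - a'\<bar>) * indicator ({0..h} \<times> {0..h}) (a, a') \<partial>lborel \<partial>lborel)
    \<le> (\<integral>\<^sup>+a. \<integral>\<^sup>+a'. \<phi> a * \<phi> (a' - a) + \<phi> a' * \<phi> (a - a') \<partial>lborel \<partial>lborel)"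
    by (intro nn_integral_mono) (auto simp: \<phi>_def indicator_def min_def abs_real_def)
  also have "\<dots> = (\<integral>\<^sup>+a. \<integral>\<^sup>+a'. \<phi> a * \<phi> (a' - a) \<partial>lborel \<partial>lborel) + (\<integral>\<^sup>+a. \<integral>\<^sup>+a'. \<phi> a' * \<phi> (a - a') \<partial>lborel \<partial>lborel)"
    by (simp add: nn_integral_add)
  also have "(\<integral>\<^sup>+a. \<integral>\<^sup>+a'. \<phi> a' * \<phi> (a - a') \<partial>lborel \<partial>lborel) = (\<integral>\<^sup>+a'. \<integral>\<^sup>+a. \<phi> a' * \<phi> (a - a') \<partial>lborel \<partial>lborel)"
    by (intro lborel_pair.Fubini') simp
  also have "(\<integral>\<^sup>+a. \<integral>\<^sup>+a'. \<phi> a * \<phi> (a' - a) \<partial>lborel \<partial>lborel) = (\<integral>\<^sup>+u. \<phi> u \<partial>lborel)\<^sup>2"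
    by (simp add: nn_integral_cmult nn_integral_multc shift power2_eq_square)
  finally show ?thesis
    by (simp add: mult_2)
qed

text \<open>Tonelli, for use with second moments (\<open>k = k'\<close>) and mixed moments
  alike.\<close>

lemma nn_integral_mult_nn_integral:
  assumes "sigma_finite_measure N" "sigma_finite_measure M"
    and [measurable]: "case_prod k \<in> borel_measurable (N \<Otimes>\<^sub>M M)" "case_prod k' \<in> borel_measurable (N \<Otimes>\<^sub>M M)"
  shows "(\<integral>\<^sup>+\<omega>. (\<integral>\<^sup>+p. k p \<omega> \<partial>N) * (\<integral>\<^sup>+p. k' p \<omega> \<partial>N) \<partial>M) =
    (\<integral>\<^sup>+p. \<integral>\<^sup>+p'. \<integral>\<^sup>+\<omega>. k p \<omega> * k' p' \<omega> \<partial>M \<partial>N \<partial>N)"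
proof -
  interpret N: sigma_finite_measure N by fact
  interpret M: sigma_finite_measure M by fact
  interpret NM: pair_sigma_finite N M ..
  have "(\<integral>\<^sup>+\<omega>. (\<integral>\<^sup>+p. k p \<omega> \<partial>N) * (\<integral>\<^sup>+p. k' p \<omega> \<partial>N) \<partial>M) = (\<integral>\<^sup>+\<omega>. \<integral>\<^sup>+p. k p \<omega> * (\<integral>\<^sup>+p'. k' p' \<omega> \<partial>N) \<partial>N \<partial>M)"
    by (intro nn_integral_cong nn_integral_multc[symmetric]) simp
  also have "\<dots> = (\<integral>\<^sup>+p. \<integral>\<^sup>+\<omega>. k p \<omega> * (\<integral>\<^sup>+p'. k' p' \<omega> \<partial>N) \<partial>M \<partial>N)"
    by (intro NM.Fubini') simp
  also have "\<dots> = (\<integral>\<^sup>+p. \<integral>\<^sup>+\<omega>. \<integral>\<^sup>+p'. k p \<omega> * k' p' \<omega> \<partial>N \<partial>M \<partial>N)"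
    by (intro nn_integral_cong nn_integral_cmult[symmetric]) simp
  also have "\<dots> = (\<integral>\<^sup>+p. \<integral>\<^sup>+p'. \<integral>\<^sup>+\<omega>. k p \<omega> * k' p' \<omega> \<partial>M \<partial>N \<partial>N)"
    by (intro nn_integral_cong NM.Fubini') simp
  finally show ?thesis .
qed

lemma nn_integral_pair_product:
  assumes [measurable]: "case_prod f \<in> borel_measurable (borel \<Otimes>\<^sub>M borel)"
  shows "(\<integral>\<^sup>+p. \<integral>\<^sup>+p'. f (fst p) (fst p') * f (snd p) (snd p') \<partial>(lborel \<Otimes>\<^sub>M lborel) \<partial>(lborel \<Otimes>\<^sub>M lborel)) =
    (\<integral>\<^sup>+(a::real). \<integral>\<^sup>+(a'::real). f a a' \<partial>lborel \<partial>lborel)\<^sup>2"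
proof -
  have "(\<integral>\<^sup>+p'. f a (fst p') * f b (snd p') \<partial>(lborel \<Otimes>\<^sub>M lborel)) = (\<integral>\<^sup>+a'. f a a' \<partial>lborel) * (\<integral>\<^sup>+b'. f b b' \<partial>lborel)" for a b
    by (subst lborel.nn_integral_fst[symmetric]) (simp_all add: nn_integral_cmult nn_integral_multc)
  then show ?thesis
    by (subst lborel.nn_integral_fst[symmetric])
       (simp_all add: nn_integral_cmult nn_integral_multc power2_eq_square)
qed

text \<open>A jointly measurable process with the small ball estimates of Brownian motion. Applied to a
  continuous modification, since \<open>B\<close> itself need not be jointly measurable.\<close>

locale crossing_process = prob_space M
  for M :: "'w measure" and W :: "real \<Rightarrow> 'w \<Rightarrow> real ^ 'n" and m :: nat +
  assumes W_measurable: "(\<lambda>p. W (fst p) (snd p)) \<in> borel_measurable (borel \<Otimes>\<^sub>M M)"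
    and one_crossing: "\<And>r a b c. 0 < r \<Longrightarrow> 0 \<le> a \<Longrightarrow> 0 \<le> b \<Longrightarrow> 0 \<le> c - a \<Longrightarrow> c + b \<le> 1 \<Longrightarrow>
      emeasure M {\<omega> \<in> space M. norm (W (c + b) \<omega> - W (c - a) \<omega>) \<le> r} \<le> weight m r a * weight m r b"
    and two_crossings: "\<And>r a b a' b' c. 0 < r \<Longrightarrow> 0 \<le> a \<Longrightarrow> 0 \<le> b \<Longrightarrow> 0 \<le> c - a \<Longrightarrow> c + b \<le> 1 \<Longrightarrow>
      0 \<le> a' \<Longrightarrow> 0 \<le> b' \<Longrightarrow> 0 \<le> c - a' \<Longrightarrow> c + b' \<le> 1 \<Longrightarrow>
      emeasure M {\<omega> \<in> space M. norm (W (c + b) \<omega> - W (c - a) \<omega>) \<le> r \<and> norm (W (c + b') \<omega> - W (c - a') \<omega>) \<le> r}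
      \<le> (weight m r (min a a') * weight m r \<bar>a - a'\<bar>) * (weight m r (min b b') * weight m r \<bar>b - b'\<bar>)"
    and disjoint_crossings: "\<And>r t0 t1 t2 t3. 0 \<le> t0 \<Longrightarrow> t0 \<le> t1 \<Longrightarrow> t1 \<le> t2 \<Longrightarrow> t2 \<le> t3 \<Longrightarrow> t3 \<le> 1 \<Longrightarrow>
      emeasure M {\<omega> \<in> space M. norm (W t1 \<omega> - W t0 \<omega>) \<le> r \<and> norm (W t3 \<omega> - W t2 \<omega>) \<le> r} =
      emeasure M {\<omega> \<in> space M. norm (W t1 \<omega> - W t0 \<omega>) \<le> r} * emeasure M {\<omega> \<in> space M. norm (W t3 \<omega> - W t2 \<omega>) \<le> r}"
begin

definition close :: "real \<Rightarrow> real \<Rightarrow> real \<Rightarrow> 'w \<Rightarrow> ennreal" where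
  "close r s t \<omega> = indicator {x. norm x \<le> r} (W t \<omega> - W s \<omega>)"

lemma measurable_close[measurable (raw)]:
  assumes [measurable]: "f \<in> borel_measurable N" "g \<in> borel_measurable N" "h \<in> measurable N M"
  shows "(\<lambda>x. close r (f x) (g x) (h x)) \<in> borel_measurable N"
proof -
  have [measurable]: "(\<lambda>x. W (f x) (h x)) \<in> borel_measurable N" if [measurable]: "f \<in> borel_measurable N" for f
    using measurable_compose[OF _ W_measurable, of "\<lambda>x. (f x, h x)" N] by simp
  show ?thesis
    unfolding close_def by measurable
qed

lemma close_commute: "close r s t = close r t s"
  by (auto simp: close_def fun_eq_iff indicator_def norm_minus_commute)

lemma close_le_1: "close r s t \<omega> \<le> 1"
  by (simp add: close_def indicator_def)

lemma W_pair_sets[measurable]: "{\<omega> \<in> space M. norm (W t \<omega> - W s \<omega>) \<le> r} \<in> sets M"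
proof -
  have [measurable]: "W t \<in> borel_measurable M" for t
    using measurable_compose[OF _ W_measurable, of "\<lambda>x. (t, x)" M] by simp
  show ?thesis by measurable
qed

lemma nn_integral_close: "(\<integral>\<^sup>+\<omega>. close r s t \<omega> \<partial>M) = emeasure M {\<omega> \<in> space M. norm (W t \<omega> - W s \<omega>) \<le> r}"
proof -
  have "(\<integral>\<^sup>+\<omega>. close r s t \<omega> \<partial>M) = (\<integral>\<^sup>+\<omega>. indicator {\<omega> \<in> space M. norm (W t \<omega> - W s \<omega>) \<le> r} \<omega> \<partial>M)"
    by (intro nn_integral_cong) (simp add: close_def indicator_def)
  then show ?thesis by simp
qed

lemma nn_integral_close_mult:
  "(\<integral>\<^sup>+\<omega>. close r s t \<omega> * close r s' t' \<omega> \<partial>M) =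
    emeasure M {\<omega> \<in> space M. norm (W t \<omega> - W s \<omega>) \<le> r \<and> norm (W t' \<omega> - W s' \<omega>) \<le> r}"
proof -
  have "{\<omega> \<in> space M. norm (W t \<omega> - W s \<omega>) \<le> r \<and> norm (W t' \<omega> - W s' \<omega>) \<le> r} =
    {\<omega> \<in> space M. norm (W t \<omega> - W s \<omega>) \<le> r} \<inter> {\<omega> \<in> space M. norm (W t' \<omega> - W s' \<omega>) \<le> r}"
    by auto
  then show ?thesis
    by (simp flip: nn_integral_indicator)
       (auto simp: close_def indicator_def intro!: nn_integral_cong)
qed

text \<open>The components of \<open>p\<close> are the distances of the two times from
  \<open>c\<close>, the coordinates in which the small ball bounds factor.\<close>

definition crossing_kernel :: "real \<Rightarrow> real \<Rightarrow> real \<Rightarrow> real \<times> real \<Rightarrow> 'w \<Rightarrow> ennreal" where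
  "crossing_kernel r c h p \<omega> = indicator ({0..h} \<times> {0..h}) p * close r (c - fst p) (c + snd p) \<omega>"

definition crossing :: "real \<Rightarrow> real \<Rightarrow> real \<Rightarrow> 'w \<Rightarrow> ennreal" where
  "crossing r c h \<omega> = (\<integral>\<^sup>+p. crossing_kernel r c h p \<omega> \<partial>(lborel \<Otimes>\<^sub>M lborel))"

lemma measurable_crossing_kernel[measurable]:
  "(\<lambda>(p, \<omega>). crossing_kernel r c h p \<omega>) \<in> borel_measurable ((lborel \<Otimes>\<^sub>M lborel) \<Otimes>\<^sub>M M)"
  unfolding crossing_kernel_def[abs_def] by measurable

lemma measurable_crossing[measurable]: "crossing r c h \<in> borel_measurable M"
  unfolding crossing_def[abs_def] by measurable

lemma sigma_finite_lborel_pair: "sigma_finite_measure (lborel \<Otimes>\<^sub>M (lborel :: real measure) :: (real \<times> real) measure)"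
  by (simp add: lborel_prod lborel.sigma_finite_measure_axioms)

lemma crossing_le: "0 \<le> h \<Longrightarrow> crossing r c h \<omega> \<le> ennreal (h\<^sup>2)"
proof -
  assume h: "0 \<le> h"
  have "crossing r c h \<omega> \<le> (\<integral>\<^sup>+p. indicator ({0..h} \<times> {0..h}) p \<partial>(lborel \<Otimes>\<^sub>M lborel))"
    unfolding crossing_def crossing_kernel_def
    by (intro nn_integral_mono) (auto simp: close_le_1 split: split_indicator)
  also have "\<dots> = ennreal (h\<^sup>2)"
    using h by (simp add: lborel.emeasure_pair_measure_Times power2_eq_square ennreal_mult)
  finally show ?thesis .
qed

lemma nn_integral_crossing_le:
  assumes "0 < r" "0 \<le> h" "h \<le> c" "c + h \<le> 1"
  shows "(\<integral>\<^sup>+\<omega>. crossing r c h \<omega> \<partial>M) \<le> (\<integral>\<^sup>+u\<in>{0..h}. weight m r u \<partial>lborel)\<^sup>2"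
proof -
  interpret P: sigma_finite_measure "lborel \<Otimes>\<^sub>M (lborel :: real measure) :: (real \<times> real) measure"
    by (rule sigma_finite_lborel_pair)
  interpret PM: pair_sigma_finite "lborel \<Otimes>\<^sub>M (lborel :: real measure) :: (real \<times> real) measure" M ..
  have "(\<integral>\<^sup>+\<omega>. crossing r c h \<omega> \<partial>M) = (\<integral>\<^sup>+p. \<integral>\<^sup>+\<omega>. crossing_kernel r c h p \<omega> \<partial>M \<partial>(lborel \<Otimes>\<^sub>M lborel))"
    unfolding crossing_def by (intro PM.Fubini') simp
  also have "\<dots> \<le> (\<integral>\<^sup>+p. (weight m r (fst p) * indicator {0..h} (fst p)) * (weight m r (snd p) * indicator {0..h} (snd p)) \<partial>(lborel \<Otimes>\<^sub>M lborel))"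
  proof (intro nn_integral_mono)
    fix p :: "real \<times> real"
    show "(\<integral>\<^sup>+\<omega>. crossing_kernel r c h p \<omega> \<partial>M) \<le> (weight m r (fst p) * indicator {0..h} (fst p)) * (weight m r (snd p) * indicator {0..h} (snd p))"
      using one_crossing[of r "fst p" "snd p" c] assms
      by (cases "p \<in> {0..h} \<times> {0..h}") (auto simp: crossing_kernel_def nn_integral_close)
  qed
  also have "\<dots> = (\<integral>\<^sup>+u\<in>{0..h}. weight m r u \<partial>lborel)\<^sup>2"
    by (subst lborel.nn_integral_fst[symmetric])
       (simp_all add: nn_integral_cmult nn_integral_multc power2_eq_square)
  finally show ?thesis .
qed

text \<open>Up to a factor 4 this is the square of the bound for the mean, so a single number per
  scale will control both moments.\<close>

lemma nn_integral_crossing_square_le: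
  assumes "0 < r" "0 \<le> h" "h \<le> c" "c + h \<le> 1"
  shows "(\<integral>\<^sup>+\<omega>. (crossing r c h \<omega>)\<^sup>2 \<partial>M) \<le> (2 * (\<integral>\<^sup>+u\<in>{0..h}. weight m r u \<partial>lborel)\<^sup>2)\<^sup>2"
proof -
  define f where "f a a' = (weight m r (min a a') * weight m r \<bar>a - a'\<bar>) * indicator ({0..h} \<times> {0..h}) (a, a')" for a a'
  have [measurable]: "case_prod f \<in> borel_measurable (borel \<Otimes>\<^sub>M borel)"
    unfolding f_def[abs_def] by measurable
  have "(\<integral>\<^sup>+\<omega>. (crossing r c h \<omega>)\<^sup>2 \<partial>M) = (\<integral>\<^sup>+p. \<integral>\<^sup>+p'. \<integral>\<^sup>+\<omega>. crossing_kernel r c h p \<omega> * crossing_kernel r c h p' \<omega> \<partial>M \<partial>(lborel \<Otimes>\<^sub>M lborel) \<partial>(lborel \<Otimes>\<^sub>M lborel))"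
    unfolding crossing_def power2_eq_square
    by (intro nn_integral_mult_nn_integral sigma_finite_lborel_pair) (simp_all add: sigma_finite_measure_axioms)
  also have "\<dots> \<le> (\<integral>\<^sup>+p. \<integral>\<^sup>+p'. f (fst p) (fst p') * f (snd p) (snd p') \<partial>(lborel \<Otimes>\<^sub>M lborel) \<partial>(lborel \<Otimes>\<^sub>M lborel))"
  proof (intro nn_integral_mono)
    fix p p' :: "real \<times> real"
    show "(\<integral>\<^sup>+\<omega>. crossing_kernel r c h p \<omega> * crossing_kernel r c h p' \<omega> \<partial>M) \<le> f (fst p) (fst p') * f (snd p) (snd p')"
      using two_crossings[of r "fst p" "snd p" c "fst p'" "snd p'"] assms
      by (cases "p \<in> {0..h} \<times> {0..h}"; cases "p' \<in> {0..h} \<times> {0..h}")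
         (auto simp: crossing_kernel_def nn_integral_close_mult f_def)
  qed
  also have "\<dots> = (\<integral>\<^sup>+a. \<integral>\<^sup>+a'. f a a' \<partial>lborel \<partial>lborel)\<^sup>2"
    by (rule nn_integral_pair_product) simp
  also have "\<dots> \<le> (2 * (\<integral>\<^sup>+u\<in>{0..h}. weight m r u \<partial>lborel)\<^sup>2)\<^sup>2"
    unfolding f_def by (intro power_mono nn_integral_weight_convolution_le) simp
  finally show ?thesis .
qed

lemma nn_integral_crossing_mult:
  assumes "0 \<le> h" "h \<le> c" "c + h \<le> c' - h" "c' + h \<le> 1"
  shows "(\<integral>\<^sup>+\<omega>. crossing r c h \<omega> * crossing r c' h \<omega> \<partial>M) =
    (\<integral>\<^sup>+\<omega>. crossing r c h \<omega> \<partial>M) * (\<integral>\<^sup>+\<omega>. crossing r c' h \<omega> \<partial>M)"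
proof -
  interpret P: sigma_finite_measure "lborel \<Otimes>\<^sub>M (lborel :: real measure) :: (real \<times> real) measure"
    by (rule sigma_finite_lborel_pair)
  interpret PM: pair_sigma_finite "lborel \<Otimes>\<^sub>M (lborel :: real measure) :: (real \<times> real) measure" M ..
  let ?L = "lborel \<Otimes>\<^sub>M (lborel :: real measure) :: (real \<times> real) measure"
  have E: "(\<integral>\<^sup>+\<omega>. crossing r c h \<omega> \<partial>M) = (\<integral>\<^sup>+p. \<integral>\<^sup>+\<omega>. crossing_kernel r c h p \<omega> \<partial>M \<partial>?L)" for c
    unfolding crossing_def by (intro PM.Fubini') simp
  have *: "(\<integral>\<^sup>+\<omega>. crossing_kernel r c h p \<omega> * crossing_kernel r c' h p' \<omega> \<partial>M) =
    (\<integral>\<^sup>+\<omega>. crossing_kernel r c h p \<omega> \<partial>M) * (\<integral>\<^sup>+\<omega>. crossing_kernel r c' h p' \<omega> \<partial>M)" for p p'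
    using disjoint_crossings[of "c - fst p" "c + snd p" "c' - fst p'" "c' + snd p'" r] assms
    by (cases "p \<in> {0..h} \<times> {0..h}"; cases "p' \<in> {0..h} \<times> {0..h}")
       (auto simp: crossing_kernel_def nn_integral_close_mult nn_integral_close)
  have "(\<integral>\<^sup>+\<omega>. crossing r c h \<omega> * crossing r c' h \<omega> \<partial>M) = (\<integral>\<^sup>+p. \<integral>\<^sup>+p'. \<integral>\<^sup>+\<omega>. crossing_kernel r c h p \<omega> * crossing_kernel r c' h p' \<omega> \<partial>M \<partial>?L \<partial>?L)"
    unfolding crossing_def
    by (intro nn_integral_mult_nn_integral sigma_finite_lborel_pair) (simp_all add: sigma_finite_measure_axioms)
  also have "\<dots> = (\<integral>\<^sup>+p. \<integral>\<^sup>+\<omega>. crossing_kernel r c h p \<omega> \<partial>M \<partial>?L) * (\<integral>\<^sup>+p'. \<integral>\<^sup>+\<omega>. crossing_kernel r c' h p' \<omega> \<partial>M \<partial>?L)"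
    unfolding * by (simp add: nn_integral_cmult nn_integral_multc)
  finally show ?thesis
    unfolding E .
qed

end

section \<open>Variances of sums and almost sure bounds\<close>

lemma square_le_if_abs_le: "\<bar>x\<bar> \<le> K \<Longrightarrow> x\<^sup>2 \<le> K\<^sup>2" for x K :: real
  using power_mono[of "\<bar>x\<bar>" K 2] by simp

lemma abs_mult_le: "\<bar>x\<bar> \<le> K \<Longrightarrow> \<bar>y\<bar> \<le> K \<Longrightarrow> \<bar>x * y\<bar> \<le> K * K" for x y K :: real
  unfolding abs_mult by (intro mult_mono) auto

lemma (in prob_space) variance_sum_uncorrelated_le:
  fixes X :: "'i \<Rightarrow> 'a \<Rightarrow> real" and v :: real
  assumes I: "finite I"
    and rv[measurable]: "\<And>i. i \<in> I \<Longrightarrow> X i \<in> borel_measurable M"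
    and bounded: "\<And>i \<omega>. i \<in> I \<Longrightarrow> \<bar>X i \<omega>\<bar> \<le> K"
    and uncorrelated: "\<And>i j. i \<in> I \<Longrightarrow> j \<in> I \<Longrightarrow> i \<noteq> j \<Longrightarrow>
      expectation (\<lambda>\<omega>. X i \<omega> * X j \<omega>) = expectation (X i) * expectation (X j)"
    and second_moment: "\<And>i. i \<in> I \<Longrightarrow> expectation (\<lambda>\<omega>. (X i \<omega>)\<^sup>2) \<le> v"
  shows "variance (\<lambda>\<omega>. \<Sum>i\<in>I. X i \<omega>) \<le> card I * v"
proof -
  have int: "integrable M (X i)" if "i \<in> I" for i
    using that bounded by (intro integrable_const_bound[where B=K]) auto
  have int2: "integrable M (\<lambda>\<omega>. X i \<omega> * X j \<omega>)" if "i \<in> I" "j \<in> I" for i j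
    using that abs_mult_le[OF bounded bounded]
    by (intro integrable_const_bound[where B="K * K"]) (auto intro!: AE_I2)
  have sq: "(\<Sum>i\<in>I. X i \<omega>)\<^sup>2 = (\<Sum>i\<in>I. \<Sum>j\<in>I. X i \<omega> * X j \<omega>)" for \<omega>
    by (simp add: power2_eq_square sum_product)
  have "variance (\<lambda>\<omega>. \<Sum>i\<in>I. X i \<omega>) = expectation (\<lambda>\<omega>. (\<Sum>i\<in>I. X i \<omega>)\<^sup>2) - (expectation (\<lambda>\<omega>. \<Sum>i\<in>I. X i \<omega>))\<^sup>2"
    using int int2 by (intro variance_eq) (auto simp: sq)
  also have "\<dots> = (\<Sum>i\<in>I. \<Sum>j\<in>I. expectation (\<lambda>\<omega>. X i \<omega> * X j \<omega>) - expectation (X i) * expectation (X j))"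
    using int int2 by (simp add: sq power2_eq_square sum_product sum_subtractf)
  also have "\<dots> = (\<Sum>i\<in>I. \<Sum>j\<in>I. if j = i then expectation (\<lambda>\<omega>. (X i \<omega>)\<^sup>2) - (expectation (X i))\<^sup>2 else 0)"
    using uncorrelated by (intro sum.cong) (auto simp: power2_eq_square)
  also have "\<dots> = (\<Sum>i\<in>I. expectation (\<lambda>\<omega>. (X i \<omega>)\<^sup>2) - (expectation (X i))\<^sup>2)"
    using I by simp
  also have "\<dots> \<le> (\<Sum>i\<in>I. v)"
  proof (intro sum_mono)
    fix i assume "i \<in> I"
    then show "expectation (\<lambda>\<omega>. (X i \<omega>)\<^sup>2) - (expectation (X i))\<^sup>2 \<le> v"
      using second_moment[of i] zero_le_power2[of "expectation (X i)"] by linarith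
  qed
  finally show ?thesis by simp
qed

text \<open>Minkowski's inequality for standard deviations, obtained from Cauchy-Schwarz by writing
  each deviation \<open>D i\<close> as
  \<open>sqrt (\<sigma> i) * (D i / sqrt (\<sigma> i))\<close>.\<close>

lemma (in prob_space) variance_sum_le:
  fixes X :: "'i \<Rightarrow> 'a \<Rightarrow> real"
  assumes I: "finite I"
    and rv[measurable]: "\<And>i. i \<in> I \<Longrightarrow> X i \<in> borel_measurable M"
    and bounded: "\<And>i \<omega>. i \<in> I \<Longrightarrow> \<bar>X i \<omega>\<bar> \<le> K"
    and \<sigma>: "\<And>i. i \<in> I \<Longrightarrow> 0 < \<sigma> i" "\<And>i. i \<in> I \<Longrightarrow> variance (X i) \<le> (\<sigma> i)\<^sup>2"
  shows "variance (\<lambda>\<omega>. \<Sum>i\<in>I. X i \<omega>) \<le> (\<Sum>i\<in>I. \<sigma> i)\<^sup>2"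
proof -
  define D where "D i \<omega> = X i \<omega> - expectation (X i)" for i \<omega>
  have int: "integrable M (X i)" if "i \<in> I" for i
    using that bounded by (intro integrable_const_bound[where B=K]) auto
  have D[measurable]: "D i \<in> borel_measurable M" if "i \<in> I" for i
    unfolding D_def using that by measurable
  have D_bound: "\<bar>D i \<omega>\<bar> \<le> K + \<bar>expectation (X i)\<bar>" if "i \<in> I" for i \<omega>
    using bounded[OF that, of \<omega>] unfolding D_def by linarith
  have D_bound2: "(D i \<omega>)\<^sup>2 \<le> (K + \<bar>expectation (X i)\<bar>)\<^sup>2" if "i \<in> I" for i \<omega>
    by (intro square_le_if_abs_le D_bound that)
  have int_D2: "integrable M (\<lambda>\<omega>. (D i \<omega>)\<^sup>2)" if "i \<in> I" for i
    using that D_bound2[OF that] by (intro integrable_const_bound[where B="(K + \<bar>expectation (X i)\<bar>)\<^sup>2"]) auto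
  have cauchy: "(\<Sum>i\<in>I. D i \<omega>)\<^sup>2 \<le> (\<Sum>i\<in>I. \<sigma> i) * (\<Sum>i\<in>I. (D i \<omega>)\<^sup>2 / \<sigma> i)" for \<omega>
  proof -
    have "(\<Sum>i\<in>I. D i \<omega>) = (\<Sum>i\<in>I. sqrt (\<sigma> i) * (D i \<omega> / sqrt (\<sigma> i)))"
      using \<sigma>(1) by (intro sum.cong) (auto simp: less_imp_neq[THEN not_sym])
    also have "\<dots>\<^sup>2 \<le> (\<Sum>i\<in>I. (sqrt (\<sigma> i))\<^sup>2) * (\<Sum>i\<in>I. (D i \<omega> / sqrt (\<sigma> i))\<^sup>2)"
      by (rule Cauchy_Schwarz_ineq_sum)
    also have "\<dots> = (\<Sum>i\<in>I. \<sigma> i) * (\<Sum>i\<in>I. (D i \<omega>)\<^sup>2 / \<sigma> i)"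
      using \<sigma>(1) by (intro arg_cong2[where f="(*)"] sum.cong) (auto simp: power_divide less_imp_le)
    finally show ?thesis .
  qed
  have "variance (\<lambda>\<omega>. \<Sum>i\<in>I. X i \<omega>) = expectation (\<lambda>\<omega>. (\<Sum>i\<in>I. D i \<omega>)\<^sup>2)"
    using int by (simp add: D_def sum_subtractf)
  also have "\<dots> \<le> expectation (\<lambda>\<omega>. (\<Sum>i\<in>I. \<sigma> i) * (\<Sum>i\<in>I. (D i \<omega>)\<^sup>2 / \<sigma> i))"
    using int_D2 cauchy by (intro integral_mono') (auto intro!: sum_nonneg mult_nonneg_nonneg divide_nonneg_nonneg dest: \<sigma>(1))
  also have "\<dots> = (\<Sum>i\<in>I. \<sigma> i) * (\<Sum>i\<in>I. variance (X i) / \<sigma> i)"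
    using int_D2 by (simp add: D_def)
  also have "\<dots> \<le> (\<Sum>i\<in>I. \<sigma> i) * (\<Sum>i\<in>I. \<sigma> i)"
    using \<sigma> by (intro mult_left_mono sum_mono sum_nonneg)
       (auto simp: divide_simps power2_eq_square less_imp_le less_imp_neq[THEN not_sym])
  finally show ?thesis
    by (simp add: power2_eq_square)
qed

text \<open>The squared deviations in units of \<open>h k\<close> have summable expectations, so
  their sum is almost surely finite, and it dominates every single term. \<open>K k\<close> serves
  integrability only and may grow with k.\<close>

lemma (in prob_space) AE_bounded_by_moments:
  fixes V :: "nat \<Rightarrow> 'a \<Rightarrow> real"
  assumes [measurable]: "\<And>k. V k \<in> borel_measurable M" and bounded: "\<And>k \<omega>. \<bar>V k \<omega>\<bar> \<le> K k"
    and h: "\<And>k. 0 < h k" and mean: "\<And>k. expectation (V k) \<le> c * h k"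
    and var: "\<And>k. variance (V k) \<le> v k" and summable: "summable (\<lambda>k. v k / (h k)\<^sup>2)"
  shows "AE \<omega> in M. \<exists>C. \<forall>k. V k \<omega> \<le> C * h k"
proof -
  define Q where "Q k \<omega> = ((V k \<omega> - expectation (V k)) / h k)\<^sup>2" for k \<omega>
  have "\<bar>V k \<omega> - expectation (V k)\<bar> \<le> K k + \<bar>expectation (V k)\<bar>" for k \<omega>
    using bounded[of k \<omega>] by linarith
  then have "(V k \<omega> - expectation (V k))\<^sup>2 \<le> (K k + \<bar>expectation (V k)\<bar>)\<^sup>2" for k \<omega>
    by (rule square_le_if_abs_le)
  then have "integrable M (\<lambda>\<omega>. (V k \<omega> - expectation (V k))\<^sup>2)" for k
    by (intro integrable_const_bound[where B="(K k + \<bar>expectation (V k)\<bar>)\<^sup>2"]) auto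
  then have int: "integrable M (Q k)" "expectation (Q k) = variance (V k) / (h k)\<^sup>2" for k
    by (simp_all add: Q_def[abs_def] power_divide)
  have [measurable]: "Q k \<in> borel_measurable M" for k
    unfolding Q_def by measurable
  have "0 \<le> v k" for k
    using var[of k] variance_positive[of "V k"] by linarith
  then have v: "0 \<le> v k / (h k)\<^sup>2" for k
    by simp
  have "(\<integral>\<^sup>+\<omega>. (\<Sum>k. ennreal (Q k \<omega>)) \<partial>M) = (\<Sum>k. \<integral>\<^sup>+\<omega>. ennreal (Q k \<omega>) \<partial>M)"
    by (intro nn_integral_suminf) simp
  also have "\<dots> = (\<Sum>k. ennreal (expectation (Q k)))"
    using int by (subst nn_integral_eq_integral) (auto simp: Q_def)
  also have "\<dots> \<le> (\<Sum>k. ennreal (v k / (h k)\<^sup>2))"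
    using var h by (intro suminf_le ennreal_leI) (auto simp: int divide_right_mono)
  also have "\<dots> = ennreal (\<Sum>k. v k / (h k)\<^sup>2)"
    using v summable by (intro suminf_ennreal2)
  also have "\<dots> < \<infinity>"
    by simp
  finally have "AE \<omega> in M. (\<Sum>k. ennreal (Q k \<omega>)) \<noteq> \<infinity>"
    by (intro nn_integral_PInf_AE) auto
  then show ?thesis
  proof eventually_elim
    case (elim \<omega>)
    define q where "q = enn2real (\<Sum>k. ennreal (Q k \<omega>))"
    \<comment> \<open>\<open>c\<close> accounts for the mean; the normalised deviation is at most
      \<open>1 + q\<close> because x <= 1 + x^2 and \<open>q\<close> bounds all the squares.\<close>
    have "V k \<omega> \<le> (c + (1 + q)) * h k" for k
    proof -
      have "ennreal (Q k \<omega>) \<le> (\<Sum>k. ennreal (Q k \<omega>))"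
        using sum_le_suminf[of "\<lambda>k. ennreal (Q k \<omega>)" "{k}"] by simp
      also have "\<dots> = ennreal q"
        using elim by (simp add: q_def less_top)
      finally have "Q k \<omega> \<le> q"
        by (simp add: q_def)
      moreover have "x \<le> 1 + x\<^sup>2" for x :: real
      proof -
        have "0 \<le> (x - 1 / 2)\<^sup>2" by simp
        then show ?thesis by (simp add: power2_eq_square algebra_simps)
      qed
      ultimately have "(V k \<omega> - expectation (V k)) / h k \<le> 1 + q"
        unfolding Q_def by (meson add_left_mono order_trans)
      then have "V k \<omega> - expectation (V k) \<le> (1 + q) * h k"
        using h[of k] by (simp add: pos_divide_le_eq)
      then show ?thesis
        using mean[of k] by (simp add: algebra_simps)
    qed
    then show ?case by blast
  qed
qed

section \<open>Moments of the dyadic level sums\<close>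

context crossing_process
begin

definition crossing_time :: "real \<Rightarrow> real \<Rightarrow> real \<Rightarrow> 'w \<Rightarrow> real" where
  "crossing_time r c h \<omega> = enn2real (crossing r c h \<omega>)"

lemma measurable_crossing_time[measurable]: "crossing_time r c h \<in> borel_measurable M"
  unfolding crossing_time_def[abs_def] by measurable

lemma crossing_time_nonneg: "0 \<le> crossing_time r c h \<omega>"
  by (simp add: crossing_time_def)

lemma ennreal_crossing_time: "0 \<le> h \<Longrightarrow> ennreal (crossing_time r c h \<omega>) = crossing r c h \<omega>"
  using crossing_le[of h r c \<omega>] unfolding crossing_time_def
  by (metis ennreal_enn2real ennreal_less_top leD order_less_le_trans top.not_eq_extremum linorder_not_le order_le_less_trans)

lemma crossing_time_le: "0 \<le> h \<Longrightarrow> crossing_time r c h \<omega> \<le> h\<^sup>2"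
  using crossing_le[of h r c \<omega>] ennreal_crossing_time[of h r c \<omega>]
  by (metis ennreal_le_iff zero_le_power2)

lemma expectation_crossing_time:
  assumes "0 \<le> h"
  shows "ennreal (expectation (crossing_time r c h)) = (\<integral>\<^sup>+\<omega>. crossing r c h \<omega> \<partial>M)"
    "ennreal (expectation (\<lambda>\<omega>. crossing_time r c h \<omega> * crossing_time r c' h \<omega>)) = (\<integral>\<^sup>+\<omega>. crossing r c h \<omega> * crossing r c' h \<omega> \<partial>M)"
proof -
  have b: "\<bar>crossing_time r c h \<omega>\<bar> \<le> h\<^sup>2" for c \<omega>
    using crossing_time_le[OF assms] crossing_time_nonneg by simp
  have "integrable M (crossing_time r c h)"
    using b by (intro integrable_const_bound[where B="h\<^sup>2"]) auto
  then show "ennreal (expectation (crossing_time r c h)) = (\<integral>\<^sup>+\<omega>. crossing r c h \<omega> \<partial>M)"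
    by (subst nn_integral_eq_integral[symmetric]) (auto simp: ennreal_crossing_time assms crossing_time_nonneg)
  have "integrable M (\<lambda>\<omega>. crossing_time r c h \<omega> * crossing_time r c' h \<omega>)"
    using abs_mult_le[OF b b] by (intro integrable_const_bound[where B="h\<^sup>2 * h\<^sup>2"] AE_I2) auto
  then show "ennreal (expectation (\<lambda>\<omega>. crossing_time r c h \<omega> * crossing_time r c' h \<omega>)) = (\<integral>\<^sup>+\<omega>. crossing r c h \<omega> * crossing r c' h \<omega> \<partial>M)"
    by (subst nn_integral_eq_integral[symmetric])
       (auto simp: ennreal_crossing_time assms crossing_time_nonneg ennreal_mult)
qed

text \<open>At scale \<open>j\<close>, the pairs of times in the same dyadic interval of length \<open>1 / 2 ^ j\<close> but in
  different halves of it.\<close>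

definition level :: "real \<Rightarrow> nat \<Rightarrow> 'w \<Rightarrow> real" where
  "level r j \<omega> = (\<Sum>i<2 ^ j. crossing_time r ((2 * real i + 1) / 2 ^ Suc j) (1 / 2 ^ Suc j) \<omega>)"

lemma measurable_level[measurable]: "level r j \<in> borel_measurable M"
  unfolding level_def[abs_def] by measurable

lemma level_nonneg: "0 \<le> level r j \<omega>"
  unfolding level_def by (intro sum_nonneg crossing_time_nonneg)

lemma level_le: "level r j \<omega> \<le> 1"
proof -
  have "level r j \<omega> \<le> (\<Sum>i<(2::nat) ^ j. (1 / 2 ^ Suc j)\<^sup>2)"
    unfolding level_def by (intro sum_mono crossing_time_le) simp
  also have "\<dots> = 1 / (4 * 2 ^ j)"
    by (simp add: power2_eq_square)
  also have "\<dots> \<le> 1"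
  proof -
    have "(1::real) \<le> 2 ^ j" by simp
    then have "1 \<le> 4 * (2::real) ^ j" by linarith
    then show ?thesis by (simp add: divide_le_eq)
  qed
  finally show ?thesis .
qed

lemma level_moments:
  assumes r: "0 < r" and a: "(\<integral>\<^sup>+u\<in>{0..1 / 2 ^ Suc j}. weight m r u \<partial>lborel)\<^sup>2 \<le> ennreal a" "0 \<le> a"
  shows "expectation (level r j) \<le> 2 ^ j * a" "variance (level r j) \<le> 2 ^ j * (2 * a)\<^sup>2"
proof -
  define h :: real where "h = 1 / 2 ^ Suc j"
  define c where "c i = (2 * real i + 1) / 2 ^ Suc j" for i
  have h: "0 \<le> h" by (simp add: h_def)
  have c: "h \<le> c i" "c i + h \<le> 1" if "i < 2 ^ j" for i
  proof -
    show "h \<le> c i" by (simp add: h_def c_def divide_right_mono)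
    have "real i + 1 \<le> real (2 ^ j)"
      using that by (metis Suc_eq_plus1 Suc_leI of_nat_1 of_nat_add of_nat_mono)
    then show "c i + h \<le> 1"
      by (simp add: h_def c_def add_divide_distrib[symmetric] divide_le_eq)
  qed
  \<comment> \<open>Equality holds for consecutive indices.\<close>
  have sep: "c i + h \<le> c i' - h" if "i < i'" for i i'
  proof -
    have "real i + 1 \<le> real i'"
      using that by linarith
    moreover have "c i + h = (2 * real i + 2) / 2 ^ Suc j" "c i' - h = 2 * real i' / 2 ^ Suc j"
      by (simp_all add: h_def c_def add_divide_distrib diff_divide_distrib)
    ultimately show ?thesis
      by (simp add: divide_right_mono del: power_Suc)
  qed
  have b: "\<bar>crossing_time r c h \<omega>\<bar> \<le> h\<^sup>2" for c \<omega>
    using crossing_time_le[OF h] crossing_time_nonneg by simp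
  have int: "integrable M (crossing_time r c h)" for c
    using b by (intro integrable_const_bound[where B="h\<^sup>2"]) auto
  have level: "level r j = (\<lambda>\<omega>. \<Sum>i<2 ^ j. crossing_time r (c i) h \<omega>)"
    by (simp add: level_def[abs_def] c_def h_def)
  have e1: "expectation (crossing_time r (c i) h) \<le> a" if "i < 2 ^ j" for i
  proof -
    have "ennreal (expectation (crossing_time r (c i) h)) \<le> ennreal a"
      using nn_integral_crossing_le[OF r h c[OF that]] a(1) unfolding expectation_crossing_time[OF h] unfolding h_def
      by (rule order_trans)
    then show ?thesis using a by simp
  qed
  have e2: "expectation (\<lambda>\<omega>. (crossing_time r (c i) h \<omega>)\<^sup>2) \<le> (2 * a)\<^sup>2" if "i < 2 ^ j" for i
  proof -
    have "ennreal (expectation (\<lambda>\<omega>. (crossing_time r (c i) h \<omega>)\<^sup>2)) \<le> (2 * (\<integral>\<^sup>+u\<in>{0..h}. weight m r u \<partial>lborel)\<^sup>2)\<^sup>2"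
      using nn_integral_crossing_square_le[OF r h c[OF that]] 
      unfolding power2_eq_square[of "crossing_time _ _ _ _"] expectation_crossing_time[OF h] power2_eq_square[of "crossing _ _ _ _"] .
    also have "\<dots> \<le> (2 * ennreal a)\<^sup>2"
      using a unfolding h_def by (intro power_mono mult_left_mono) auto
    also have "\<dots> = ennreal ((2 * a)\<^sup>2)"
      using a(2) by (simp add: ennreal_mult' flip: ennreal_power)
    finally show ?thesis by simp
  qed
  have unc: "expectation (\<lambda>\<omega>. crossing_time r (c i) h \<omega> * crossing_time r (c i') h \<omega>) =
      expectation (crossing_time r (c i) h) * expectation (crossing_time r (c i') h)"
    if "i < i'" "i' < 2 ^ j" for i i'
  proof -
    have "ennreal (expectation (\<lambda>\<omega>. crossing_time r (c i) h \<omega> * crossing_time r (c i') h \<omega>)) =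
      ennreal (expectation (crossing_time r (c i) h) * expectation (crossing_time r (c i') h))"
      using that nn_integral_crossing_mult[OF h c(1) sep c(2), of i i' r]
      by (simp add: ennreal_mult Bochner_Integration.integral_nonneg crossing_time_nonneg expectation_crossing_time[OF h])
    then show ?thesis
      by (subst (asm) ennreal_inj) (auto intro!: Bochner_Integration.integral_nonneg mult_nonneg_nonneg crossing_time_nonneg)
  qed
  have "expectation (level r j) = (\<Sum>i<2 ^ j. expectation (crossing_time r (c i) h))"
    using int by (simp add: level)
  also have "\<dots> \<le> (\<Sum>i<(2::nat) ^ j. a)"
    using e1 by (intro sum_mono) auto
  finally show "expectation (level r j) \<le> 2 ^ j * a"
    by simp
  have "variance (level r j) \<le> card {..<(2::nat) ^ j} * (2 * a)\<^sup>2"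
    unfolding level
  proof (intro variance_sum_uncorrelated_le[where K="h\<^sup>2"])
    fix i i' assume "i \<in> {..<(2::nat) ^ j}" "i' \<in> {..<(2::nat) ^ j}" "i \<noteq> i'"
    then show "expectation (\<lambda>\<omega>. crossing_time r (c i) h \<omega> * crossing_time r (c i') h \<omega>) =
      expectation (crossing_time r (c i) h) * expectation (crossing_time r (c i') h)"
      using unc[of i i'] unc[of i' i] by (cases "i < i'") (auto simp: mult.commute)
  qed (use b e2 in auto)
  then show "variance (level r j) \<le> 2 ^ j * (2 * a)\<^sup>2"
    by simp
qed

text \<open>Different scales use overlapping stretches of the path and need not be uncorrelated, so
  Minkowski replaces orthogonality; \<open>sqrt 2 ^ j * (2 * a j)\<close> is the standard deviation
  bound of level j.\<close>

lemma level_sum_moments: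
  assumes r: "0 < r"
    and a: "\<And>j. (\<integral>\<^sup>+u\<in>{0..1 / 2 ^ Suc j}. weight m r u \<partial>lborel)\<^sup>2 \<le> ennreal (a j)" "\<And>j. 0 < a j"
  shows "expectation (\<lambda>\<omega>. \<Sum>j<J. level r j \<omega>) \<le> (\<Sum>j<J. 2 ^ j * a j)"
    "variance (\<lambda>\<omega>. \<Sum>j<J. level r j \<omega>) \<le> (\<Sum>j<J. sqrt 2 ^ j * (2 * a j))\<^sup>2"
proof -
  have int: "integrable M (level r j)" for j
    using level_le level_nonneg by (intro integrable_const_bound[where B=1]) auto
  have "expectation (\<lambda>\<omega>. \<Sum>j<J. level r j \<omega>) = (\<Sum>j<J. expectation (level r j))"
    using int by simp
  also have "\<dots> \<le> (\<Sum>j<J. 2 ^ j * a j)"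
    using level_moments(1)[OF r a(1)] a(2) by (intro sum_mono) (auto simp: less_imp_le)
  finally show "expectation (\<lambda>\<omega>. \<Sum>j<J. level r j \<omega>) \<le> (\<Sum>j<J. 2 ^ j * a j)" .
  show "variance (\<lambda>\<omega>. \<Sum>j<J. level r j \<omega>) \<le> (\<Sum>j<J. sqrt 2 ^ j * (2 * a j))\<^sup>2"
  proof (intro variance_sum_le[where K=1])
    fix j
    have "(2::real) ^ j * (2 * a j)\<^sup>2 = (sqrt 2 ^ j * (2 * a j))\<^sup>2"
      by (simp add: power_mult_distrib flip: power_mult[of _ j 2] mult.commute[of 2 j]) (simp add: power_mult)
    then show "variance (level r j) \<le> (sqrt 2 ^ j * (2 * a j))\<^sup>2"
      using level_moments(2)[OF r a(1), of j] a(2)[of j] by simp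
  qed (use a(2) level_le level_nonneg in auto)
qed

end

subsection \<open>Self-intersections at dyadic scales\<close>

text \<open>For the variance series in dimension three, whose terms are multiples of k^2 /
  4^k.\<close>

lemma square_le_twice_two_power: "(real k)\<^sup>2 \<le> 2 * 2 ^ k"
proof (cases "3 \<le> k")
  case True
  then show ?thesis
  proof (induction k rule: nat_induct_at_least)
    case (Suc k)
    have "3 * real k \<le> real k * real k"
      using Suc(1) by (intro mult_right_mono) auto
    then have "real k * real k + 2 * real k + 1 \<le> 2 * (real k * real k)"
      using Suc(1) by linarith
    then have "(real (Suc k))\<^sup>2 \<le> 2 * (real k)\<^sup>2"
      unfolding power2_eq_square of_nat_Suc by (simp only: distrib_left distrib_right)
    then show ?case
      using Suc(2) by simp
  qed simp
next
  case False
  then have "k = 0 \<or> k = 1 \<or> k = 2" by linarith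
  then show ?thesis by auto
qed

lemma sum_lessThan_double: "(\<Sum>i<2 * n. g i) = (\<Sum>i<n. g (2 * i) + g (2 * i + 1))" for g :: "nat \<Rightarrow> 'b::comm_monoid_add"
  by (induction n) (simp_all add: add.assoc)

lemma sqrt_two_bounds: "4 / 3 \<le> sqrt 2" "sqrt 2 \<le> 3 / 2"
  by (rule real_le_rsqrt, simp add: power2_eq_square) (rule real_le_lsqrt, simp_all add: power2_eq_square)

text \<open>The constants are (1 / (1 - m/4))^2 for m = 2 and m = 3.\<close>

lemma nn_integral_weight_square:
  assumes "0 < r" "0 \<le> h"
  shows "(\<integral>\<^sup>+u\<in>{0..h}. weight 2 r u \<partial>lborel)\<^sup>2 = ennreal (4 * r\<^sup>2 * h)"
    and "(\<integral>\<^sup>+u\<in>{0..h}. weight 3 r u \<partial>lborel)\<^sup>2 = ennreal (16 * r ^ 3 * sqrt h)"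
proof -
  have "(h powr (1 / 4))\<^sup>2 = sqrt h"
    using assms by (simp add: power2_eq_square powr_half_sqrt flip: powr_add)
  then show "(\<integral>\<^sup>+u\<in>{0..h}. weight 3 r u \<partial>lborel)\<^sup>2 = ennreal (16 * r ^ 3 * sqrt h)"
    using assms by (simp add: nn_integral_weight ennreal_power power_mult_distrib power_divide)
  show "(\<integral>\<^sup>+u\<in>{0..h}. weight 2 r u \<partial>lborel)\<^sup>2 = ennreal (4 * r\<^sup>2 * h)"
    using assms by (simp add: nn_integral_weight ennreal_power power_mult_distrib powr_half_sqrt)
qed

text \<open>The order of the expected time that the path spends within distance \<open>1 / 2 ^ k\<close> of
  itself, for \<open>m = 2\<close> and \<open>m = 3\<close>.\<close>

definition rate :: "nat \<Rightarrow> nat \<Rightarrow> real" where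
  "rate m k = (if m = 2 then real k + 1 else 1) / 4 ^ k"

lemma rate_pos: "0 < rate m k"
  by (simp add: rate_def)

section \<open>Level sums in dimensions two and three\<close>

context crossing_process
begin

text \<open>Every scale contributes the same mean 2 / 4^k, and the 2k scales produce the factor k of
  \<open>rate\<close>, hence the logarithm. The standard deviations decay geometrically in j and add
  up to order 4^-k; relative to \<open>rate\<close> this leaves 256 / (k+1)^2 for the variances, a
  convergent series.\<close>

lemma AE_level_sum_le_2:
  assumes m: "m = 2"
  shows "AE \<omega> in M. \<exists>C. \<forall>k. (\<Sum>j<2 * k. level (1 / 2 ^ k) j \<omega>) \<le> C * rate m k"
proof (rule AE_bounded_by_moments)
  fix k
  \<comment> \<open>This is 4 r^2 h with r = 2^-k and h = 2^-(j+1).\<close>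
  define a where "a j = 2 / 4 ^ k / (2::real) ^ j" for j :: nat
  have a0: "0 < a j" for j by (simp add: a_def)
  have "(\<integral>\<^sup>+u\<in>{0..1 / 2 ^ Suc j}. weight m (1 / 2 ^ k) u \<partial>lborel)\<^sup>2 \<le> ennreal (a j)" for j
  proof -
    have "4 * (1 / 2 ^ k)\<^sup>2 * (1 / 2 ^ Suc j) = a j"
      by (simp add: a_def power_divide flip: power_mult) (simp add: power_mult mult.commute[of k])
    then show ?thesis
      using nn_integral_weight_square(1)[of "1 / 2 ^ k" "1 / 2 ^ Suc j"] by (simp add: m del: power_Suc)
  qed
  note * = level_sum_moments[of "1 / 2 ^ k" a "2 * k", OF _ this a0, simplified]
  show "expectation (\<lambda>\<omega>. \<Sum>j<2 * k. level (1 / 2 ^ k) j \<omega>) \<le> 4 * rate m k"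
    using *(1) by (simp add: a_def rate_def m divide_simps split: if_splits)
  have "(\<Sum>j<2 * k. sqrt 2 ^ j * (2 * a j)) = 4 / 4 ^ k * (\<Sum>j<2 * k. (1 / sqrt 2) ^ j)"
  proof -
    have "sqrt 2 / 2 = 1 / sqrt 2"
      by (simp add: field_simps)
    then have "(1 / sqrt 2) ^ j = sqrt 2 ^ j / 2 ^ j" for j
      by (metis power_divide)
    then have "sqrt 2 ^ j * (2 * a j) = 4 / 4 ^ k * (1 / sqrt 2) ^ j" for j
      by (simp add: a_def del: power_one_over)
    then show ?thesis
      by (simp add: sum_distrib_left)
  qed
  also have "\<dots> \<le> 4 / 4 ^ k * 4"
  proof (intro mult_left_mono)
    have "(\<Sum>j<2 * k. (1 / sqrt 2) ^ j) \<le> (\<Sum>j. (1 / sqrt 2) ^ j)"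
      by (intro sum_le_suminf summable_geometric) (auto simp: power_one_over divide_simps)
    also have "\<dots> = 1 / (1 - 1 / sqrt 2)"
      by (intro suminf_geometric) auto
    also have "\<dots> \<le> 4"
      using sqrt_two_bounds by (simp add: divide_simps)
    finally show "(\<Sum>j<2 * k. (1 / sqrt 2) ^ j) \<le> 4" .
  qed simp
  finally have "(\<Sum>j<2 * k. sqrt 2 ^ j * (2 * a j))\<^sup>2 \<le> (4 / 4 ^ k * 4)\<^sup>2"
    using a0 by (intro power_mono sum_nonneg) (auto simp: less_imp_le)
  then show "variance (\<lambda>\<omega>. \<Sum>j<2 * k. level (1 / 2 ^ k) j \<omega>) \<le> (4 / 4 ^ k * 4)\<^sup>2"
    using *(2) by linarith
next
  have "summable (\<lambda>k. 256 * inverse (real (Suc k) ^ 2))"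
    using inverse_power_summable[of 2, where 'a=real]
    by (intro summable_mult) (simp add: summable_Suc_iff[of "\<lambda>n. inverse (real n ^ 2)"] del: of_nat_Suc)
  then show "summable (\<lambda>k. (4 / 4 ^ k * 4)\<^sup>2 / (rate m k)\<^sup>2)"
    by (simp add: rate_def m power_divide field_simps)
next
  fix k \<omega>
  have "(\<Sum>j<2 * k. level (1 / 2 ^ k) j \<omega>) \<le> (\<Sum>j<2 * k. 1)"
    by (intro sum_mono level_le)
  then show "\<bar>\<Sum>j<2 * k. level (1 / 2 ^ k) j \<omega>\<bar> \<le> real (2 * k)"
    by (simp add: sum_nonneg level_nonneg)
qed (auto simp: rate_pos)

text \<open>The means grow like sqrt 2 ^ j and are dominated by the finest scale, where sqrt 2 ^
  (2k) / 8^k = 4^-k: no logarithm. The standard deviation bounds are equal on all 2k scales, with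
  total 64 k / 8^k, smaller than the target by a factor of order k / 2^k.\<close>

lemma AE_level_sum_le_3:
  assumes m: "m = 3"
  shows "AE \<omega> in M. \<exists>C. \<forall>k. (\<Sum>j<2 * k. level (1 / 2 ^ k) j \<omega>) \<le> C * rate m k"
proof (rule AE_bounded_by_moments)
  fix k
  \<comment> \<open>This is 16 r^3 sqrt h with r = 2^-k and h = 2^-(j+1), after dropping a factor 1
    / sqrt 2.\<close>
  define a where "a j = 16 / 8 ^ k / sqrt 2 ^ j" for j :: nat
  have a0: "0 < a j" for j by (simp add: a_def)
  have "(\<integral>\<^sup>+u\<in>{0..1 / 2 ^ Suc j}. weight m (1 / 2 ^ k) u \<partial>lborel)\<^sup>2 \<le> ennreal (a j)" for j
  proof -
    have "sqrt (1 / 2 ^ Suc j) \<le> 1 / sqrt 2 ^ j"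
      by (simp add: real_sqrt_divide real_sqrt_mult real_sqrt_power divide_simps)
    then have "16 * (1 / 2 ^ k) ^ 3 * sqrt (1 / 2 ^ Suc j) \<le> 16 * (1 / 2 ^ k) ^ 3 * (1 / sqrt 2 ^ j)"
      by (intro mult_left_mono) auto
    also have "\<dots> = a j"
      by (simp add: a_def power_divide flip: power_mult) (simp add: power_mult mult.commute[of k])
    finally show ?thesis
      using nn_integral_weight_square(2)[of "1 / 2 ^ k" "1 / 2 ^ Suc j"] by (simp add: m ennreal_leI del: power_Suc)
  qed
  note * = level_sum_moments[of "1 / 2 ^ k" a "2 * k", OF _ this a0, simplified]
  have "(\<Sum>j<2 * k. 2 ^ j * a j) = 16 / 8 ^ k * (\<Sum>j<2 * k. sqrt 2 ^ j)"
  proof -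
    have "2 ^ j / sqrt 2 ^ j = sqrt 2 ^ j" for j
      by (simp add: real_div_sqrt flip: power_divide)
    then show ?thesis
      by (simp add: a_def sum_distrib_left field_simps)
  qed
  also have "\<dots> \<le> 16 / 8 ^ k * (3 * 2 ^ k)"
  proof (intro mult_left_mono)
    have "(\<Sum>j<2 * k. sqrt 2 ^ j) = (sqrt 2 ^ (2 * k) - 1) / (sqrt 2 - 1)"
      using sqrt_two_bounds by (intro geometric_sum) auto
    also have "sqrt 2 ^ (2 * k) = 2 ^ k"
      by (simp add: power_mult)
    also have "(2 ^ k - 1) / (sqrt 2 - 1) \<le> 2 ^ k / (1 / 3)"
      using sqrt_two_bounds by (intro frac_le) auto
    finally show "(\<Sum>j<2 * k. sqrt 2 ^ j) \<le> 3 * 2 ^ k" by simp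
  qed simp
  also have "\<dots> = 48 * rate m k"
  proof -
    have "(8::real) ^ k = 2 ^ k * 4 ^ k" by (simp flip: power_mult_distrib)
    then show ?thesis by (simp add: rate_def m)
  qed
  finally show "expectation (\<lambda>\<omega>. \<Sum>j<2 * k. level (1 / 2 ^ k) j \<omega>) \<le> 48 * rate m k"
    using *(1) by linarith
  have "(\<Sum>j<2 * k. sqrt 2 ^ j * (2 * a j)) = 64 * real k / 8 ^ k"
    by (simp add: a_def)
  then show "variance (\<lambda>\<omega>. \<Sum>j<2 * k. level (1 / 2 ^ k) j \<omega>) \<le> (64 * real k / 8 ^ k)\<^sup>2"
    using *(2) by simp
next
  have "norm ((64 * real k / 8 ^ k)\<^sup>2 / (rate m k)\<^sup>2) \<le> 8192 * (1 / 2) ^ k" for k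
  proof -
    have "(64 * real k / 8 ^ k)\<^sup>2 / (rate m k)\<^sup>2 = 4096 * ((real k)\<^sup>2 * ((1 / 2) ^ k * (1 / 2) ^ k))"
    proof -
      have "(8::real) ^ k = 2 ^ k * 4 ^ k" by (simp flip: power_mult_distrib)
      then show ?thesis by (simp add: rate_def m power2_eq_square power_one_over field_simps)
    qed
    also have "\<dots> \<le> 4096 * ((2 * 2 ^ k) * ((1 / 2) ^ k * (1 / 2) ^ k))"
      by (intro mult_left_mono mult_right_mono square_le_twice_two_power) auto
    also have "\<dots> = 8192 * (1 / 2) ^ k"
      by (simp add: power_divide)
    finally show ?thesis by simp
  qed
  then show "summable (\<lambda>k. (64 * real k / 8 ^ k)\<^sup>2 / (rate m k)\<^sup>2)"
    by (rule summable_comparison_test'[OF summable_mult[OF summable_geometric], rotated]) simp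
next
  fix k \<omega>
  have "(\<Sum>j<2 * k. level (1 / 2 ^ k) j \<omega>) \<le> (\<Sum>j<2 * k. 1)"
    by (intro sum_mono level_le)
  then show "\<bar>\<Sum>j<2 * k. level (1 / 2 ^ k) j \<omega>\<bar> \<le> real (2 * k)"
    by (simp add: sum_nonneg level_nonneg)
qed (auto simp: rate_pos)

section \<open>Dyadic decomposition of the unit square of times\<close>

definition close_time :: "real \<Rightarrow> real set \<Rightarrow> real set \<Rightarrow> 'w \<Rightarrow> ennreal" where
  "close_time r S T \<omega> = (\<integral>\<^sup>+s. \<integral>\<^sup>+t. close r s t \<omega> * (indicator S s * indicator T t) \<partial>lborel \<partial>lborel)"

lemma close_time_commute:
  assumes [measurable]: "S \<in> sets borel" "T \<in> sets borel" and [simp]: "\<omega> \<in> space M"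
  shows "close_time r S T \<omega> = close_time r T S \<omega>"
proof -
  have "close_time r S T \<omega> = (\<integral>\<^sup>+t. \<integral>\<^sup>+s. close r s t \<omega> * (indicator S s * indicator T t) \<partial>lborel \<partial>lborel)"
    unfolding close_time_def by (intro lborel_pair.Fubini') simp
  then show ?thesis
    by (simp add: close_time_def close_commute[of r _ t for t] mult.commute)
qed

lemma close_time_eq_crossing:
  assumes [simp]: "\<omega> \<in> space M"
  shows "close_time r {c - h..c} {c..c + h} \<omega> = crossing r c h \<omega>"
proof -
  have "close_time r {c - h..c} {c..c + h} \<omega> =
    (\<integral>\<^sup>+a. \<integral>\<^sup>+t. close r (c - a) t \<omega> * (indicator {c - h..c} (c - a) * indicator {c..c + h} t) \<partial>lborel \<partial>lborel)"
    unfolding close_time_def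
    by (subst nn_integral_real_affine[where c="-1" and t=c]) simp_all
  also have "\<dots> = (\<integral>\<^sup>+a. \<integral>\<^sup>+b. close r (c - a) (c + b) \<omega> * (indicator {c - h..c} (c - a) * indicator {c..c + h} (c + b)) \<partial>lborel \<partial>lborel)"
    by (subst nn_integral_real_affine[where c=1 and t=c]) simp_all
  also have "\<dots> = (\<integral>\<^sup>+a. \<integral>\<^sup>+b. crossing_kernel r c h (a, b) \<omega> \<partial>lborel \<partial>lborel)"
    by (intro nn_integral_cong) (auto simp: crossing_kernel_def split: split_indicator)
  also have "\<dots> = crossing r c h \<omega>"
    unfolding crossing_def by (intro lborel.nn_integral_fst) simp
  finally show ?thesis .
qed

text \<open>Halving the interval cuts the square into two diagonal and two off-diagonal squares; the
  latter are mirror images, hence the factor 2. The closed halves share \<open>l + h\<close>, so the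
  indicators satisfy only an inequality.\<close>

lemma close_time_split:
  assumes h: "0 \<le> h" and [simp]: "\<omega> \<in> space M"
  shows "close_time r {l..l + 2 * h} {l..l + 2 * h} \<omega> \<le>
    close_time r {l..l + h} {l..l + h} \<omega> + close_time r {l + h..l + 2 * h} {l + h..l + 2 * h} \<omega> +
    2 * crossing r (l + h) h \<omega>"
proof -
  define A where "A = {l..l + h}"
  define A' where "A' = {l + h..l + 2 * h}"
  have [measurable]: "A \<in> sets borel" "A' \<in> sets borel"
    by (auto simp: A_def A'_def)
  have "close_time r {l..l + 2 * h} {l..l + 2 * h} \<omega> \<le>
    (\<integral>\<^sup>+s. \<integral>\<^sup>+t. close r s t \<omega> * (indicator A s * indicator A t) + close r s t \<omega> * (indicator A' s * indicator A' t) +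
      (close r s t \<omega> * (indicator A s * indicator A' t) + close r s t \<omega> * (indicator A' s * indicator A t)) \<partial>lborel \<partial>lborel)"
    unfolding close_time_def
  proof (intro nn_integral_mono)
    fix s t :: real
    have *: "indicator {l..l + 2 * h} u \<le> (indicator A u + indicator A' u :: ennreal)" for u
      by (auto simp: A_def A'_def split: split_indicator)
    have "close r s t \<omega> * (indicator {l..l + 2 * h} s * indicator {l..l + 2 * h} t) \<le>
      close r s t \<omega> * ((indicator A s + indicator A' s) * (indicator A t + indicator A' t))"
      by (intro mult_left_mono mult_mono *) auto
    then show "close r s t \<omega> * (indicator {l..l + 2 * h} s * indicator {l..l + 2 * h} t) \<le>
      close r s t \<omega> * (indicator A s * indicator A t) + close r s t \<omega> * (indicator A' s * indicator A' t) +
      (close r s t \<omega> * (indicator A s * indicator A' t) + close r s t \<omega> * (indicator A' s * indicator A t))"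
      by (simp only: distrib_left distrib_right ac_simps)
  qed
  also have "\<dots> = close_time r A A \<omega> + close_time r A' A' \<omega> + (close_time r A A' \<omega> + close_time r A' A \<omega>)"
    unfolding close_time_def by (simp add: nn_integral_add)
  also have "close_time r A' A \<omega> = close_time r A A' \<omega>"
    by (rule close_time_commute) simp_all
  also have "close_time r A A' \<omega> = crossing r (l + h) h \<omega>"
    using close_time_eq_crossing[of \<omega> r "l + h" h] by (simp add: A_def A'_def algebra_simps)
  finally show ?thesis
    unfolding A_def A'_def mult_2[of "crossing _ _ _ _"] .
qed

lemma close_time_dyadic_le:
  assumes [simp]: "\<omega> \<in> space M"
  shows "close_time r {0..1} {0..1} \<omega> \<le>
    (\<Sum>i<2 ^ J. close_time r {real i / 2 ^ J..(real i + 1) / 2 ^ J} {real i / 2 ^ J..(real i + 1) / 2 ^ J} \<omega>) +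
    2 * ennreal (\<Sum>j<J. level r j \<omega>)"
proof (induction J)
  case (Suc J)
  define g where "g i = close_time r {real i / 2 ^ Suc J..(real i + 1) / 2 ^ Suc J} {real i / 2 ^ Suc J..(real i + 1) / 2 ^ Suc J} \<omega>" for i :: nat
  define x where "x i = crossing_time r ((2 * real i + 1) / 2 ^ Suc J) (1 / 2 ^ Suc J) \<omega>" for i :: nat
  have step: "close_time r {real i / 2 ^ J..(real i + 1) / 2 ^ J} {real i / 2 ^ J..(real i + 1) / 2 ^ J} \<omega> \<le>
    g (2 * i) + g (2 * i + 1) + 2 * ennreal (x i)" for i
  proof -
    have "{real i / 2 ^ J..(real i + 1) / 2 ^ J} = {real (2 * i) / 2 ^ Suc J..real (2 * i) / 2 ^ Suc J + 2 * (1 / 2 ^ Suc J)}"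
      by (simp add: add_divide_distrib)
    moreover have "{real (2 * i) / 2 ^ Suc J..(real (2 * i) + 1) / 2 ^ Suc J} = {real (2 * i) / 2 ^ Suc J..real (2 * i) / 2 ^ Suc J + 1 / 2 ^ Suc J}"
      by (simp add: add_divide_distrib)
    moreover have "{real (2 * i + 1) / 2 ^ Suc J..(real (2 * i + 1) + 1) / 2 ^ Suc J} =
       {real (2 * i) / 2 ^ Suc J + 1 / 2 ^ Suc J..real (2 * i) / 2 ^ Suc J + 2 * (1 / 2 ^ Suc J)}"
      by (simp add: add_divide_distrib)
    moreover have "(2 * real i + 1) / 2 ^ Suc J = real (2 * i) / 2 ^ Suc J + 1 / 2 ^ Suc J"
      by (simp add: add_divide_distrib)
    ultimately show ?thesis
      using close_time_split[of "1 / 2 ^ Suc J" \<omega> r "real (2 * i) / 2 ^ Suc J"]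
      by (simp only: g_def x_def ennreal_crossing_time assms zero_le_divide_1_iff zero_le_power zero_le_numeral simp_thms)
  qed
  have "close_time r {0..1} {0..1} \<omega> \<le> (\<Sum>i<2 ^ J. g (2 * i) + g (2 * i + 1) + 2 * ennreal (x i)) + 2 * ennreal (\<Sum>j<J. level r j \<omega>)"
    using Suc by (rule order_trans) (intro add_right_mono sum_mono step)
  also have "\<dots> = (\<Sum>i<2 * 2 ^ J. g i) + 2 * (ennreal (level r J \<omega>) + ennreal (\<Sum>j<J. level r j \<omega>))"
    by (simp add: sum_lessThan_double sum.distrib level_def x_def sum_ennreal crossing_time_nonneg distrib_left add.assoc
             flip: sum_distrib_left del: power_Suc)
  also have "ennreal (level r J \<omega>) + ennreal (\<Sum>j<J. level r j \<omega>) = ennreal (\<Sum>j<Suc J. level r j \<omega>)"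
    by (simp add: level_nonneg sum_nonneg add.commute flip: ennreal_plus)
  finally show ?case
    unfolding g_def by simp
qed simp

text \<open>The 2^J remaining diagonal squares have total area 2^-J and are counted in full.\<close>

lemma close_time_le:
  assumes [simp]: "\<omega> \<in> space M"
  shows "close_time r {0..1} {0..1} \<omega> \<le> ennreal (1 / 2 ^ J + 2 * (\<Sum>j<J. level r j \<omega>))"
proof -
  have "close_time r {real i / 2 ^ J..(real i + 1) / 2 ^ J} {real i / 2 ^ J..(real i + 1) / 2 ^ J} \<omega> \<le> ennreal ((1 / 2 ^ J)\<^sup>2)" for i
  proof -
    let ?I = "{real i / 2 ^ J..(real i + 1) / 2 ^ J}"
    have "close_time r ?I ?I \<omega> \<le> (\<integral>\<^sup>+s. \<integral>\<^sup>+t. indicator ?I s * indicator ?I t \<partial>lborel \<partial>lborel)"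
      unfolding close_time_def by (intro nn_integral_mono) (auto simp: close_le_1 split: split_indicator)
    also have "\<dots> = ennreal ((1 / 2 ^ J)\<^sup>2)"
      by (simp add: nn_integral_cmult nn_integral_multc add_divide_distrib power2_eq_square flip: ennreal_mult)
    finally show ?thesis .
  qed
  then have "(\<Sum>i<2 ^ J. close_time r {real i / 2 ^ J..(real i + 1) / 2 ^ J} {real i / 2 ^ J..(real i + 1) / 2 ^ J} \<omega>)
    \<le> (\<Sum>i<(2::nat) ^ J. ennreal ((1 / 2 ^ J)\<^sup>2))"
    by (intro sum_mono)
  also have "\<dots> = ennreal (\<Sum>i<(2::nat) ^ J. (1 / 2 ^ J)\<^sup>2)"
    by (intro sum_ennreal) simp
  also have "(\<Sum>i<(2::nat) ^ J. (1 / 2 ^ J)\<^sup>2) = (1 / 2 ^ J :: real)"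
    by (simp add: power2_eq_square)
  finally have "close_time r {0..1} {0..1} \<omega> \<le> ennreal (1 / 2 ^ J) + 2 * ennreal (\<Sum>j<J. level r j \<omega>)"
    using close_time_dyadic_le[of \<omega> r J] by (meson add_right_mono assms order_trans)
  also have "\<dots> = ennreal (1 / 2 ^ J + 2 * (\<Sum>j<J. level r j \<omega>))"
    by (simp add: level_nonneg sum_nonneg ennreal_plus ennreal_mult')
  finally show ?thesis .
qed

lemma AE_close_time_le:
  assumes "m = 2 \<or> m = 3"
  shows "AE \<omega> in M. \<exists>C. \<forall>k. close_time (1 / 2 ^ k) {0..1} {0..1} \<omega> \<le> ennreal (C * rate m k)"
proof -
  have "AE \<omega> in M. \<exists>C. \<forall>k. (\<Sum>j<2 * k. level (1 / 2 ^ k) j \<omega>) \<le> C * rate m k"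
    using assms AE_level_sum_le_2 AE_level_sum_le_3 by blast
  moreover have "AE \<omega> in M. \<omega> \<in> space M" by simp
  ultimately show ?thesis
  proof eventually_elim
    case (elim \<omega>)
    then obtain C where C: "\<And>k. (\<Sum>j<2 * k. level (1 / 2 ^ k) j \<omega>) \<le> C * rate m k" by blast
    have "close_time (1 / 2 ^ k) {0..1} {0..1} \<omega> \<le> ennreal ((1 + 2 * C) * rate m k)" for k
    proof -
      have "1 / 2 ^ (2 * k) \<le> rate m k"
        by (simp add: rate_def power_mult divide_right_mono)
      then have "1 / 2 ^ (2 * k) + 2 * (\<Sum>j<2 * k. level (1 / 2 ^ k) j \<omega>) \<le> (1 + 2 * C) * rate m k"
        using C[of k] by (simp add: algebra_simps)
      then show ?thesis
        using close_time_le[OF elim(2), of "1 / 2 ^ k" "2 * k"] by (meson ennreal_leI order_trans)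
    qed
    then show ?case by blast
  qed
qed

end

subsection \<open>Energies of measures with few close pairs\<close>

text \<open>Distances above 1/2 cost at most \<open>f (1 / 2)\<close>. On the diagonal
  \<open>f\<close> may be infinite, but \<open>g\<close> tending to 0 forces the diagonal to have
  mass 0. Measurability of \<open>f\<close> is avoided: the integrand is replaced by a measurable
  majorant before anything is computed.\<close>

lemma energy_le_dyadic_sum:
  fixes \<nu> :: "(real ^ 'n) measure"
  assumes "prob_space \<nu>" and sets[measurable_cong]: "sets \<nu> = sets borel"
    and f: "antimono_on {0..} f"
    and G: "\<And>k. (\<integral>\<^sup>+y. \<integral>\<^sup>+x. indicator {z. norm z \<le> 1 / 2 ^ k} (x - y) \<partial>\<nu> \<partial>\<nu>) \<le> ennreal (g k)"
    and g: "g \<longlonglongrightarrow> 0"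
  shows "energy f \<nu> \<le> f (1 / 2) + (\<Sum>k. f (1 / 2 ^ Suc k) * ennreal (g k))"
proof -
  interpret prob_space \<nu> by fact
  define close where "close k x y = (indicator {z. norm z \<le> 1 / 2 ^ k} (x - y) :: ennreal)" for k and x y :: "real ^ 'n"
  define D where "D x y = (indicator {0} (x - y) :: ennreal)" for x y :: "real ^ 'n"
  have [measurable]: "(\<lambda>x. close k (a x) (b x)) \<in> borel_measurable N"
    if [measurable]: "a \<in> borel_measurable N" "b \<in> borel_measurable N" for a b k and N :: "'z measure"
    unfolding close_def by measurable
  have [measurable]: "(\<lambda>x. D (a x) (b x)) \<in> borel_measurable N"
    if [measurable]: "a \<in> borel_measurable N" "b \<in> borel_measurable N" for a b and N :: "'z measure"
    unfolding D_def by measurable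
  have pointwise: "f (norm (x - y)) \<le> f (1 / 2) + (\<Sum>k. f (1 / 2 ^ Suc k) * close k x y) + \<infinity> * D x y" for x y :: "real ^ 'n"
  proof -
    consider "x = y" | "1 / 2 < norm (x - y)" | "0 < norm (x - y)" "norm (x - y) \<le> 1 / 2"
      by fastforce
    then show ?thesis
    proof cases
      case 2
      then have "f (norm (x - y)) \<le> f (1 / 2)"
        using f by (auto simp: monotone_on_def)
      then show ?thesis
        by (simp add: add.assoc add_increasing2)
    next
      case 3
      \<comment> \<open>With n = k + 1, minimality places the distance in (2^-(k+1), 2^-k].\<close>
      define n where "n = (LEAST n. (1 / 2) ^ n < norm (x - y))"
      obtain n0 where "(1 / 2) ^ n0 < norm (x - y)"
        using real_arch_pow_inv[OF 3(1), of "1 / 2"] by auto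
      then have n: "(1 / 2) ^ n < norm (x - y)"
        unfolding n_def by (rule LeastI)
      with 3 have "n \<noteq> 0" by (cases n) auto
      then obtain k where k: "n = Suc k" by (cases n) auto
      then have "norm (x - y) \<le> (1 / 2) ^ k"
        using not_less_Least[of k "\<lambda>n. (1 / 2) ^ n < norm (x - y)"] by (auto simp: n_def)
      then have "close k x y = 1"
        by (simp add: close_def power_one_over)
      moreover have "f (norm (x - y)) \<le> f (1 / 2 ^ Suc k)"
        using f n k by (auto simp: monotone_on_def power_one_over less_imp_le)
      ultimately have "f (norm (x - y)) \<le> f (1 / 2 ^ Suc k) * close k x y"
        by simp
      also have "\<dots> \<le> (\<Sum>k. f (1 / 2 ^ Suc k) * close k x y)"
        using sum_le_suminf[of "\<lambda>k. f (1 / 2 ^ Suc k) * close k x y" "{k}"] by simp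
      finally show ?thesis
        by (simp add: add_increasing add_increasing2)
    qed (simp add: D_def)
  qed
  have "(\<integral>\<^sup>+y. \<integral>\<^sup>+x. D x y \<partial>\<nu> \<partial>\<nu>) \<le> ennreal (g k)" for k
  proof -
    have "(\<integral>\<^sup>+y. \<integral>\<^sup>+x. D x y \<partial>\<nu> \<partial>\<nu>) \<le> (\<integral>\<^sup>+y. \<integral>\<^sup>+x. close k x y \<partial>\<nu> \<partial>\<nu>)"
      by (intro nn_integral_mono) (auto simp: D_def close_def split: split_indicator)
    then show ?thesis
      using G[of k] unfolding close_def by (rule order_trans)
  qed
  moreover have "(\<lambda>k. ennreal (g k)) \<longlonglongrightarrow> ennreal 0"
    using g by (rule tendsto_ennrealI)
  ultimately have D: "(\<integral>\<^sup>+y. \<integral>\<^sup>+x. D x y \<partial>\<nu> \<partial>\<nu>) = 0"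
    by (metis LIMSEQ_le_const ennreal_0 le_zero_eq)
  have "energy f \<nu> \<le> (\<integral>\<^sup>+y. \<integral>\<^sup>+x. f (1 / 2) + (\<Sum>k. f (1 / 2 ^ Suc k) * close k x y) + \<infinity> * D x y \<partial>\<nu> \<partial>\<nu>)"
    unfolding energy_def by (intro nn_integral_mono pointwise)
  also have "\<dots> = f (1 / 2) + (\<Sum>k. f (1 / 2 ^ Suc k) * (\<integral>\<^sup>+y. \<integral>\<^sup>+x. close k x y \<partial>\<nu> \<partial>\<nu>)) + \<infinity> * (\<integral>\<^sup>+y. \<integral>\<^sup>+x. D x y \<partial>\<nu> \<partial>\<nu>)"
    by (simp add: nn_integral_add nn_integral_suminf nn_integral_cmult emeasure_space_1)
  also have "\<dots> \<le> f (1 / 2) + (\<Sum>k. f (1 / 2 ^ Suc k) * ennreal (g k))"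
    using G unfolding D close_def
    by (auto intro!: add_left_mono suminf_le mult_left_mono)
  finally show ?thesis .
qed

text \<open>The k-th term is charged to the shell (2^-(k+2), 2^-(k+1)], where \<open>f\<close> is at
  least \<open>f (1 / 2 ^ Suc k)\<close>. The shells are disjoint and stay below 1/2, away from r =
  1, where the planar weight r log (1/r) vanishes.\<close>

lemma dyadic_sum_le_nn_integral:
  fixes f :: "real \<Rightarrow> ennreal" and c :: "nat \<Rightarrow> real"
  assumes f: "antimono_on {0..} f" and c: "\<And>k. 0 \<le> c k"
    and \<psi>: "\<And>k r. 1 / 2 ^ Suc (Suc k) < r \<Longrightarrow> r \<le> 1 / 2 ^ Suc k \<Longrightarrow> c k \<le> \<psi> r"
  shows "(\<Sum>k. f (1 / 2 ^ Suc k) * ennreal (c k / 2 ^ Suc (Suc k))) \<le> (\<integral>\<^sup>+r\<in>{0..1}. ennreal (\<psi> r) * f r \<partial>lborel)"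
proof -
  define I where "I k = {1 / 2 ^ Suc (Suc k)<..1 / 2 ^ Suc k :: real}" for k :: nat
  have "f (1 / 2 ^ Suc k) * ennreal (c k / 2 ^ Suc (Suc k)) = (\<integral>\<^sup>+r. f (1 / 2 ^ Suc k) * ennreal (c k) * indicator (I k) r \<partial>lborel)" for k
  proof -
    have "emeasure lborel (I k) = ennreal (1 / 2 ^ Suc (Suc k))"
    proof -
      have "1 / 2 ^ Suc (Suc k) \<le> (1 / 2 ^ Suc k :: real)"
        by (intro divide_left_mono power_increasing) auto
      moreover have "1 / 2 ^ Suc k - 1 / 2 ^ Suc (Suc k) = (1 / 2 ^ Suc (Suc k) :: real)"
        by (simp add: field_simps)
      ultimately show ?thesis
        unfolding I_def by (subst emeasure_lborel_Ioc) simp_all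
    qed
    moreover have "ennreal (c k / 2 ^ Suc (Suc k)) = ennreal (c k) * ennreal (1 / 2 ^ Suc (Suc k))"
      using c[of k] by (simp flip: ennreal_mult)
    ultimately show ?thesis
      by (subst nn_integral_cmult_indicator) (auto simp: I_def mult.assoc)
  qed
  then have "(\<Sum>k. f (1 / 2 ^ Suc k) * ennreal (c k / 2 ^ Suc (Suc k))) =
      (\<Sum>k. \<integral>\<^sup>+r. f (1 / 2 ^ Suc k) * ennreal (c k) * indicator (I k) r \<partial>lborel)"
    by presburger
  also have "\<dots> = (\<integral>\<^sup>+r. (\<Sum>k. f (1 / 2 ^ Suc k) * ennreal (c k) * indicator (I k) r) \<partial>lborel)"
    by (intro nn_integral_suminf[symmetric]) (auto simp: I_def)
  also have "\<dots> \<le> (\<integral>\<^sup>+r\<in>{0..1}. ennreal (\<psi> r) * f r \<partial>lborel)"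
  proof (intro nn_integral_mono)
    fix r :: real
    show "(\<Sum>k. f (1 / 2 ^ Suc k) * ennreal (c k) * indicator (I k) r) \<le> ennreal (\<psi> r) * f r * indicator {0..1} r"
    proof (cases "\<exists>j. r \<in> I j")
      case True
      then obtain j where j: "r \<in> I j" by blast
      then have r: "1 / 2 ^ Suc (Suc j) < r" "r \<le> 1 / 2 ^ Suc j"
        unfolding I_def by (simp_all del: power_Suc)
      have r0: "0 < r"
        using r(1) by (rule less_trans[rotated]) simp
      have r1: "r \<le> 1"
        using r(2) by (rule order_trans) (simp add: one_le_power del: power_Suc)
      have "k = j" if k: "r \<in> I k" for k
      proof (rule ccontr)
        have *: False if "r \<in> I k" "r \<in> I j" "k < j" for k j
        proof -
          have "1 / 2 ^ Suc j \<le> (1 / 2 ^ Suc (Suc k) :: real)"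
            using that(3) by (intro divide_left_mono power_increasing) auto
          then show False
            using that(1,2) unfolding I_def greaterThanAtMost_iff by linarith
        qed
        assume "k \<noteq> j"
        then show False
          using *[OF k j] *[OF j k] by linarith
      qed
      then have "(\<lambda>k. f (1 / 2 ^ Suc k) * ennreal (c k) * indicator (I k) r) =
          (\<lambda>k. if k = j then f (1 / 2 ^ Suc k) * ennreal (c k) else 0)"
        using j by (intro ext) (metis indicator_simps mult.right_neutral mult_zero_right)
      then have "(\<Sum>k. f (1 / 2 ^ Suc k) * ennreal (c k) * indicator (I k) r) = f (1 / 2 ^ Suc j) * ennreal (c j)"
        by (simp only: sums_unique[OF sums_single, symmetric])
      also have "\<dots> \<le> f r * ennreal (\<psi> r)"
      proof (intro mult_mono ennreal_leI)
        show "f (1 / 2 ^ Suc j) \<le> f r"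
          using r0 r(2) by (intro monotone_onD[OF f]) auto
        show "c j \<le> \<psi> r"
          using r by (intro \<psi>)
      qed auto
      also have "\<dots> = ennreal (\<psi> r) * f r * indicator {0..1} r"
        using r0 r1 by (simp add: mult.commute)
      finally show ?thesis .
    qed (simp add: suminf_zero)
  qed
  finally show ?thesis .
qed

lemma energy_le_kernel_integral:
  fixes \<nu> :: "(real ^ 'n) measure"
  assumes "prob_space \<nu>" "sets \<nu> = sets borel" and f: "antimono_on {0..} f"
    and G: "\<And>k. (\<integral>\<^sup>+y. \<integral>\<^sup>+x. indicator {z. norm z \<le> 1 / 2 ^ k} (x - y) \<partial>\<nu> \<partial>\<nu>) \<le> ennreal (C * g k)"
    and C: "0 \<le> C" and g: "g \<longlonglongrightarrow> 0" "\<And>k. 0 \<le> g k" "1 \<le> g 0"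
    and K: "0 < K"
    and \<psi>: "\<And>k r. 1 / 2 ^ Suc (Suc k) < r \<Longrightarrow> r \<le> 1 / 2 ^ Suc k \<Longrightarrow> 2 ^ Suc (Suc k) * g k \<le> K * \<psi> r"
  shows "energy f \<nu> \<le> ennreal ((1 + C) * K) * (\<integral>\<^sup>+r\<in>{0..1}. ennreal (\<psi> r) * f r \<partial>lborel)"
proof -
  define S where "S = (\<Sum>k. f (1 / 2 ^ Suc k) * ennreal (g k))"
  have "(\<lambda>k. C * g k) \<longlonglongrightarrow> 0"
    using tendsto_mult_left[OF g(1), of C] by simp
  then have "energy f \<nu> \<le> f (1 / 2) + (\<Sum>k. f (1 / 2 ^ Suc k) * ennreal (C * g k))"
    by (rule energy_le_dyadic_sum[OF assms(1-4)])
  also have "(\<Sum>k. f (1 / 2 ^ Suc k) * ennreal (C * g k)) = ennreal C * S"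
    unfolding S_def using C g by (subst ennreal_suminf_cmult[symmetric]) (simp_all add: ennreal_mult mult.left_commute)
  also have "f (1 / 2) + ennreal C * S \<le> ennreal (1 + C) * S"
  proof -
    \<comment> \<open>The term for large distances is absorbed by the summand k = 0, which carries
      the same value of \<open>f\<close>.\<close>
    have "f (1 / 2) * 1 \<le> f (1 / 2) * ennreal (g 0)"
      using g(3) by (intro mult_left_mono) (auto simp flip: ennreal_1 intro: ennreal_leI)
    also have "\<dots> \<le> S"
      unfolding S_def using sum_le_suminf[of "\<lambda>k. f (1 / 2 ^ Suc k) * ennreal (g k)" "{0}"] by simp
    finally have "f (1 / 2) + ennreal C * S \<le> S + ennreal C * S"
      by (intro add_right_mono) simp
    also have "\<dots> = ennreal (1 + C) * S"
      using C by (simp add: ennreal_plus distrib_right)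
    finally show ?thesis .
  qed
  also have "S \<le> ennreal K * (\<integral>\<^sup>+r\<in>{0..1}. ennreal (\<psi> r) * f r \<partial>lborel)"
  proof -
    define c where "c k = 2 ^ Suc (Suc k) * g k / K" for k
    have c: "0 \<le> c k" for k
      using K g(2)[of k] by (simp add: c_def)
    have "ennreal (g k) = ennreal K * ennreal (c k / 2 ^ Suc (Suc k))" for k
      using K g(2)[of k] by (simp add: c_def flip: ennreal_mult)
    then have "S = ennreal K * (\<Sum>k. f (1 / 2 ^ Suc k) * ennreal (c k / 2 ^ Suc (Suc k)))"
      unfolding S_def by (subst ennreal_suminf_cmult[symmetric]) (simp add: mult.left_commute)
    also have "\<dots> \<le> ennreal K * (\<integral>\<^sup>+r\<in>{0..1}. ennreal (\<psi> r) * f r \<partial>lborel)"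
      using \<psi> K c by (intro mult_left_mono dyadic_sum_le_nn_integral[OF f])
         (auto simp: c_def divide_le_eq mult.commute[of _ K] simp del: power_Suc)
    finally show ?thesis .
  qed
  finally show ?thesis
    using C K by (simp add: ennreal_mult mult_left_mono mult.assoc)
qed

subsection \<open>Continuous modifications and occupation measures\<close>

text \<open>Rounding the time down to multiples of 1/(n+1) leaves countably many times, so the
  approximations are jointly measurable; continuity of the paths gives pointwise
  convergence.\<close>

lemma borel_measurable_continuous_process:
  fixes W :: "real \<Rightarrow> 'w \<Rightarrow> 'a::metric_space"
  assumes meas: "\<And>t. W t \<in> borel_measurable M"
    and cont: "\<And>\<omega>. \<omega> \<in> space M \<Longrightarrow> continuous_on UNIV (\<lambda>t. W t \<omega>)"
  shows "(\<lambda>p. W (fst p) (snd p)) \<in> borel_measurable (borel \<Otimes>\<^sub>M M)"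
proof (rule borel_measurable_LIMSEQ_metric)
  fix n :: nat
  show "(\<lambda>p. W (real_of_int \<lfloor>fst p * (real n + 1)\<rfloor> / (real n + 1)) (snd p)) \<in> borel_measurable (borel \<Otimes>\<^sub>M M)"
    by (rule measurable_compose_countable[where f="\<lambda>i p. W (real_of_int i / (real n + 1)) (snd p)"
          and g="\<lambda>p. \<lfloor>fst p * (real n + 1)\<rfloor>"])
       (use measurable_compose[OF measurable_snd meas] in simp_all)
next
  fix p :: "real \<times> 'w" assume "p \<in> space (borel \<Otimes>\<^sub>M M)"
  then have p: "snd p \<in> space M"
    by (auto simp: space_pair_measure)
  have "(\<lambda>n. real_of_int \<lfloor>fst p * (real n + 1)\<rfloor> / (real n + 1)) \<longlonglongrightarrow> fst p"
  proof (rule tendsto_sandwich[of "\<lambda>n. fst p - 1 / (real n + 1)" _ _ "\<lambda>_. fst p"])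
    have "fst p - 1 / (real n + 1) \<le> real_of_int \<lfloor>fst p * (real n + 1)\<rfloor> / (real n + 1)" for n
    proof -
      have "fst p - 1 / (real n + 1) = (fst p * (real n + 1) - 1) / (real n + 1)"
        by (simp add: field_simps)
      also have "\<dots> \<le> real_of_int \<lfloor>fst p * (real n + 1)\<rfloor> / (real n + 1)"
        by (intro divide_right_mono) linarith+
      finally show ?thesis .
    qed
    then show "\<forall>\<^sub>F n in sequentially. fst p - 1 / (real n + 1) \<le> real_of_int \<lfloor>fst p * (real n + 1)\<rfloor> / (real n + 1)"
      by (intro always_eventually) blast
    have "real_of_int \<lfloor>fst p * (real n + 1)\<rfloor> / (real n + 1) \<le> fst p" for n
      using floor_correct[of "fst p * (real n + 1)"] by (simp add: divide_le_eq)
    then show "\<forall>\<^sub>F n in sequentially. real_of_int \<lfloor>fst p * (real n + 1)\<rfloor> / (real n + 1) \<le> fst p"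
      by (intro always_eventually) blast
    have "(\<lambda>n. fst p - 1 / (real n + 1)) \<longlonglongrightarrow> fst p - 0"
      using LIMSEQ_inverse_real_of_nat by (intro tendsto_intros) (simp add: inverse_eq_divide add.commute)
    then show "(\<lambda>n. fst p - 1 / (real n + 1)) \<longlonglongrightarrow> fst p"
      by simp
  qed simp
  then show "(\<lambda>n. W (real_of_int \<lfloor>fst p * (real n + 1)\<rfloor> / (real n + 1)) (snd p)) \<longlonglongrightarrow> W (fst p) (snd p)"
    using continuous_on_tendsto_compose[OF cont[OF p]] by simp
qed

lemma (in brownian_motion) continuous_modification:
  obtains W where "\<And>t. W t \<in> borel_measurable M" "\<And>\<omega>. \<omega> \<in> space M \<Longrightarrow> continuous_on UNIV (\<lambda>t. W t \<omega>)"
    "AE \<omega> in M. \<forall>t\<in>{0..1}. W t \<omega> = B t \<omega>"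
proof -
  obtain N where N: "{\<omega> \<in> space M. \<not> continuous_on {0..1} (\<lambda>t. B t \<omega>)} \<subseteq> N" "emeasure M N = 0" "N \<in> sets M"
    using continuous_paths by (rule AE_E)
  \<comment> \<open>Clamping the time gives measurability and continuity at every real time; the
    measurable null set \<open>N\<close> contains all discontinuous paths.\<close>
  define W where "W t \<omega> = (if \<omega> \<in> N then 0 else B (max 0 (min 1 t)) \<omega>)" for t \<omega>
  have "W t \<in> borel_measurable M" for t
    unfolding W_def using N(3) random_variable_B[of "max 0 (min 1 t)"]
    by (intro measurable_If_set) auto
  moreover have "continuous_on UNIV (\<lambda>t. W t \<omega>)" if "\<omega> \<in> space M" for \<omega>
  proof (cases "\<omega> \<in> N")
    case False
    then have "continuous_on {0..1} (\<lambda>t. B t \<omega>)"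
      using N(1) that by auto
    then have "continuous_on UNIV (\<lambda>t. B (max 0 (min 1 t)) \<omega>)"
      by (rule continuous_on_compose2) (auto intro!: continuous_intros)
    with False show ?thesis
      by (simp add: W_def)
  qed (simp add: W_def)
  moreover have "AE \<omega> in M. \<forall>t\<in>{0..1}. W t \<omega> = B t \<omega>"
  proof -
    have "AE \<omega> in M. \<omega> \<notin> N"
      using N(2,3) by (intro AE_not_in) auto
    then show ?thesis
      by eventually_elim (auto simp: W_def)
  qed
  ultimately show thesis
    by (rule that)
qed

lemma (in brownian_motion) crossing_process_modification:
  fixes S :: "'n set"
  assumes W: "\<And>t. W t \<in> borel_measurable M" "\<And>\<omega>. \<omega> \<in> space M \<Longrightarrow> continuous_on UNIV (\<lambda>t. W t \<omega>)"
    and eq: "AE \<omega> in M. \<forall>t\<in>{0..1}. W t \<omega> = B t \<omega>"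
  shows "crossing_process M W (card S)"
proof -
  have [measurable]: "W t \<in> borel_measurable M" for t by fact
  have B[measurable]: "B t \<in> borel_measurable M" if "t \<in> {0..1}" for t
    using that by (rule random_variable_B)
  have one: "emeasure M {\<omega> \<in> space M. norm (W t \<omega> - W s \<omega>) \<le> r} =
      emeasure M {\<omega> \<in> space M. norm (B t \<omega> - B s \<omega>) \<le> r}" if st: "s \<in> {0..1}" "t \<in> {0..1}" for r s t
  proof (rule emeasure_eq_AE)
    show "AE \<omega> in M. \<omega> \<in> {\<omega> \<in> space M. norm (W t \<omega> - W s \<omega>) \<le> r} \<longleftrightarrow> \<omega> \<in> {\<omega> \<in> space M. norm (B t \<omega> - B s \<omega>) \<le> r}"
      using eq by eventually_elim (use st in auto)
  qed (use st in measurable)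
  have two: "emeasure M {\<omega> \<in> space M. norm (W t \<omega> - W s \<omega>) \<le> r \<and> norm (W t' \<omega> - W s' \<omega>) \<le> r} =
      emeasure M {\<omega> \<in> space M. norm (B t \<omega> - B s \<omega>) \<le> r \<and> norm (B t' \<omega> - B s' \<omega>) \<le> r}"
    if st: "s \<in> {0..1}" "t \<in> {0..1}" "s' \<in> {0..1}" "t' \<in> {0..1}" for r s t s' t'
  proof (rule emeasure_eq_AE)
    show "AE \<omega> in M. \<omega> \<in> {\<omega> \<in> space M. norm (W t \<omega> - W s \<omega>) \<le> r \<and> norm (W t' \<omega> - W s' \<omega>) \<le> r} \<longleftrightarrow>
        \<omega> \<in> {\<omega> \<in> space M. norm (B t \<omega> - B s \<omega>) \<le> r \<and> norm (B t' \<omega> - B s' \<omega>) \<le> r}"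
      using eq by eventually_elim (use st in auto)
  qed (use st in measurable)
  show ?thesis
  proof
    show "(\<lambda>p. W (fst p) (snd p)) \<in> borel_measurable (borel \<Otimes>\<^sub>M M)"
      using W by (rule borel_measurable_continuous_process)
  next
    fix r a b c :: real
    assume "0 < r" "0 \<le> a" "0 \<le> b" "0 \<le> c - a" "c + b \<le> 1"
    then show "emeasure M {\<omega> \<in> space M. norm (W (c + b) \<omega> - W (c - a) \<omega>) \<le> r} \<le> weight (card S) r a * weight (card S) r b"
      using crossing_ball_le[of r a b c S] by (subst one) auto
  next
    fix r a b a' b' c :: real
    assume "0 < r" "0 \<le> a" "0 \<le> b" "0 \<le> c - a" "c + b \<le> 1" "0 \<le> a'" "0 \<le> b'" "0 \<le> c - a'" "c + b' \<le> 1"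
    then show "emeasure M {\<omega> \<in> space M. norm (W (c + b) \<omega> - W (c - a) \<omega>) \<le> r \<and> norm (W (c + b') \<omega> - W (c - a') \<omega>) \<le> r}
      \<le> (weight (card S) r (min a a') * weight (card S) r \<bar>a - a'\<bar>) * (weight (card S) r (min b b') * weight (card S) r \<bar>b - b'\<bar>)"
      using two_crossings_ball_le[of r a b c a' b' S] by (subst two) auto
  next
    fix r t0 t1 t2 t3 :: real
    assume t: "0 \<le> t0" "t0 \<le> t1" "t1 \<le> t2" "t2 \<le> t3" "t3 \<le> 1"
    have "emeasure M {\<omega> \<in> space M. norm (B t1 \<omega> - B t0 \<omega>) \<le> r \<and> norm (B t3 \<omega> - B t2 \<omega>) \<le> r} =
      emeasure M {\<omega> \<in> space M. norm (B t1 \<omega> - B t0 \<omega>) \<le> r} * emeasure M {\<omega> \<in> space M. norm (B t3 \<omega> - B t2 \<omega>) \<le> r}"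
      using disjoint_pairs_ball_eq[OF t, of r] by (simp add: emeasure_eq_measure flip: ennreal_mult)
    then show "emeasure M {\<omega> \<in> space M. norm (W t1 \<omega> - W t0 \<omega>) \<le> r \<and> norm (W t3 \<omega> - W t2 \<omega>) \<le> r} =
      emeasure M {\<omega> \<in> space M. norm (W t1 \<omega> - W t0 \<omega>) \<le> r} * emeasure M {\<omega> \<in> space M. norm (W t3 \<omega> - W t2 \<omega>) \<le> r}"
      using t by (simp add: one two)
  qed
qed

lemma measurable_restrict_lborel_if_continuous:
  fixes X :: "real \<Rightarrow> real ^ 'n"
  assumes "continuous_on {0..1} X"
  shows "X \<in> borel_measurable (restrict_space lborel {0..1})"
  using borel_measurable_continuous_on_restrict[OF assms]
  by (simp cong: measurable_cong_sets add: sets_restrict_space)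

lemma nn_integral_occupation_measure:
  fixes X :: "real \<Rightarrow> real ^ 'n"
  assumes "continuous_on {0..1} X" and [measurable]: "g \<in> borel_measurable borel"
  shows "(\<integral>\<^sup>+x. g x \<partial>occupation_measure X) = (\<integral>\<^sup>+t. g (X t) * indicator {0..1} t \<partial>lborel)"
  using measurable_restrict_lborel_if_continuous[OF assms(1)]
  by (simp add: occupation_measure_def nn_integral_distr nn_integral_restrict_space)

lemma prob_space_occupation_measure:
  fixes X :: "real \<Rightarrow> real ^ 'n"
  assumes "continuous_on {0..1} X"
  shows "prob_space (occupation_measure X)"
proof
  have "(\<integral>\<^sup>+x. 1 \<partial>occupation_measure X) = 1"
    using assms by (subst nn_integral_occupation_measure) simp_all
  then show "emeasure (occupation_measure X) (space (occupation_measure X)) = 1"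
    by simp
qed

lemma (in crossing_process) nn_integral_occupation_measure_close:
  assumes \<omega>: "\<omega> \<in> space M" and cont: "continuous_on {0..1} (\<lambda>t. W t \<omega>)"
  defines "\<nu> \<equiv> occupation_measure (\<lambda>t. W t \<omega>)"
  shows "(\<integral>\<^sup>+y. \<integral>\<^sup>+x. indicator {z. norm z \<le> r} (x - y) \<partial>\<nu> \<partial>\<nu>) = close_time r {0..1} {0..1} \<omega>"
proof -
  interpret \<nu>: prob_space \<nu>
    unfolding \<nu>_def using cont by (rule prob_space_occupation_measure)
  have [measurable_cong]: "sets \<nu> = sets borel"
    by (simp add: \<nu>_def occupation_measure_def)
  have inner: "(\<integral>\<^sup>+x. indicator {z. norm z \<le> r} (x - y) \<partial>\<nu>) =
      (\<integral>\<^sup>+t. indicator {z. norm z \<le> r} (W t \<omega> - y) * indicator {0..1} t \<partial>lborel)" for y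
    unfolding \<nu>_def using cont by (rule nn_integral_occupation_measure) simp
  have "(\<lambda>y. \<integral>\<^sup>+x. indicator {z. norm z \<le> r} (x - y) \<partial>\<nu>) \<in> borel_measurable borel"
    by measurable
  then have "(\<integral>\<^sup>+y. \<integral>\<^sup>+x. indicator {z. norm z \<le> r} (x - y) \<partial>\<nu> \<partial>\<nu>) =
      (\<integral>\<^sup>+s. (\<integral>\<^sup>+x. indicator {z. norm z \<le> r} (x - W s \<omega>) \<partial>\<nu>) * indicator {0..1} s \<partial>lborel)"
    unfolding \<nu>_def using cont by (intro nn_integral_occupation_measure)
  also have "\<dots> = close_time r {0..1} {0..1} \<omega>"
    unfolding inner close_time_def close_def
    by (intro nn_integral_cong) (auto split: split_indicator)
  finally show ?thesis .
qed

text \<open>The exceptional set is fixed by the bounds on \<open>close_time\<close> before any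
  kernel is chosen; the passage to energies is then pathwise.\<close>

lemma AE_energy_le:
  fixes M :: "'w measure" and B :: "real \<Rightarrow> 'w \<Rightarrow> real ^ 'n"
  assumes "brownian_motion M B" and m: "m = 2 \<or> m = 3" "m \<le> CARD('n)"
    and \<psi>: "\<And>k r. 1 / 2 ^ Suc (Suc k) < r \<Longrightarrow> r \<le> 1 / 2 ^ Suc k \<Longrightarrow> 2 ^ Suc (Suc k) * rate m k \<le> K * \<psi> r"
    and K: "0 < K"
  shows "AE \<omega> in M. \<exists>C::ennreal. C < \<infinity> \<and> (\<forall>f. energy_kernel f \<longrightarrow>
    energy f (occupation_measure (\<lambda>t. B t \<omega>)) \<le> C * (\<integral>\<^sup>+r\<in>{0..1}. ennreal (\<psi> r) * f r \<partial>lborel))"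
proof -
  interpret brownian_motion M B by fact
  obtain S :: "'n set" where S: "card S = m"
    using m(2) obtain_subset_with_card_n by metis
  obtain W where W: "\<And>t. W t \<in> borel_measurable M" "\<And>\<omega>. \<omega> \<in> space M \<Longrightarrow> continuous_on UNIV (\<lambda>t. W t \<omega>)"
    "AE \<omega> in M. \<forall>t\<in>{0..1}. W t \<omega> = B t \<omega>"
    using continuous_modification by blast
  interpret W: crossing_process M W m
    using crossing_process_modification[OF W, of S] by (simp add: S)
  \<comment> \<open>This rules out diagonal mass for the occupation measure.\<close>
  have rate0: "rate m \<longlonglongrightarrow> 0"
  proof (rule tendsto_sandwich[of "\<lambda>_. 0" _ _ "\<lambda>k. 2 * (1 / 2) ^ k"])
    have "rate m k \<le> 2 * (1 / 2) ^ k" for k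
    proof -
      have "real k + 1 \<le> 2 * 2 ^ k"
        using of_nat_less_two_power[of k, where 'a=real] one_le_power[of "2::real" k] by linarith
      then have "(if m = 2 then real k + 1 else 1) \<le> 2 * 2 ^ k"
        by auto
      then have "rate m k \<le> 2 * 2 ^ k / 4 ^ k"
        unfolding rate_def by (intro divide_right_mono) auto
      also have "\<dots> = 2 * (1 / 2) ^ k"
      proof -
        have "(4::real) ^ k = 2 ^ k * 2 ^ k" by (simp flip: power_mult_distrib)
        then show ?thesis by (simp add: power_one_over)
      qed
      finally show ?thesis .
    qed
    then show "\<forall>\<^sub>F k in sequentially. rate m k \<le> 2 * (1 / 2) ^ k"
      by simp
    show "(\<lambda>k. 2 * (1 / 2 :: real) ^ k) \<longlonglongrightarrow> 0"
      by (intro tendsto_mult_right_zero LIMSEQ_realpow_zero) auto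
  qed (auto simp: rate_pos less_imp_le)
  have "AE \<omega> in M. \<exists>C. \<forall>k. W.close_time (1 / 2 ^ k) {0..1} {0..1} \<omega> \<le> ennreal (C * rate m k)"
    using m(1) by (rule W.AE_close_time_le)
  moreover have "AE \<omega> in M. \<omega> \<in> space M" by simp
  ultimately show ?thesis
    using W(3)
  proof eventually_elim
    case (elim \<omega>)
    define \<nu> where "\<nu> = occupation_measure (\<lambda>t. B t \<omega>)"
    have \<nu>: "\<nu> = occupation_measure (\<lambda>t. W t \<omega>)"
      unfolding \<nu>_def occupation_measure_def using elim(3)
      by (intro distr_cong) (auto simp: space_restrict_space)
    have cont: "continuous_on {0..1} (\<lambda>t. W t \<omega>)"
      using W(2)[OF elim(2)] by (rule continuous_on_subset) simp
    obtain C where C: "\<And>k. W.close_time (1 / 2 ^ k) {0..1} {0..1} \<omega> \<le> ennreal (C * rate m k)"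
      using elim(1) by blast
    have G: "(\<integral>\<^sup>+y. \<integral>\<^sup>+x. indicator {z. norm z \<le> 1 / 2 ^ k} (x - y) \<partial>\<nu> \<partial>\<nu>) \<le> ennreal (\<bar>C\<bar> * rate m k)" for k
    proof -
      have "C * rate m k \<le> \<bar>C\<bar> * rate m k"
        using rate_pos[of m k] by (intro mult_right_mono) auto
      then show ?thesis
        using C[of k] unfolding \<nu> W.nn_integral_occupation_measure_close[OF elim(2) cont]
        by (meson ennreal_leI order_trans)
    qed
    have "energy f \<nu> \<le> ennreal ((1 + \<bar>C\<bar>) * K) * (\<integral>\<^sup>+r\<in>{0..1}. ennreal (\<psi> r) * f r \<partial>lborel)" if "energy_kernel f" for f
    proof (rule energy_le_kernel_integral[OF _ _ _ G])
      show "prob_space \<nu>"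
        unfolding \<nu> using cont by (rule prob_space_occupation_measure)
      show "sets \<nu> = sets borel"
        by (simp add: \<nu> occupation_measure_def)
      show "antimono_on {0..} f"
        using that by (simp add: energy_kernel_def)
    qed (use rate0 rate_pos \<psi> K in \<open>auto simp: less_imp_le rate_def[of m 0]\<close>)
    then show ?case
      unfolding \<nu>_def by (intro exI[of _ "ennreal ((1 + \<bar>C\<bar>) * K)"]) auto
  qed
qed

theorem theorem1p4:
  fixes M :: "'w measure" and B :: "real \<Rightarrow> 'w \<Rightarrow> real ^ 'n"
  assumes "CARD('n) \<ge> 2"
    and "brownian_motion M B"
  shows "AE \<omega> in M. \<exists>C::ennreal. C < \<infinity> \<and> (\<forall>f. energy_kernel f \<longrightarrow>
      (CARD('n) \<ge> 3 \<longrightarrow>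
        energy f (occupation_measure (\<lambda>t. B t \<omega>))
          \<le> C * (\<integral>\<^sup>+r\<in>{0..1}. ennreal r * f r \<partial>lborel)) \<and>
      (CARD('n) = 2 \<longrightarrow>
        energy f (occupation_measure (\<lambda>t. B t \<omega>))
          \<le> C * (\<integral>\<^sup>+r\<in>{0..1}. ennreal (r * ln (1 / r)) * f r \<partial>lborel)))"
proof -
  \<comment> \<open>The left side equals 4 / 2^k, sixteen times the lower end of the shell.\<close>
  have three: "2 ^ Suc (Suc k) * rate 3 k \<le> 16 * r" if "1 / 2 ^ Suc (Suc k) < r" for k and r :: real
  proof -
    have "2 ^ Suc (Suc k) * rate 3 k = 16 * (1 / 2 ^ Suc (Suc k))"
    proof -
      have "(4::real) ^ k = 2 ^ k * 2 ^ k" by (simp flip: power_mult_distrib)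
      then show ?thesis by (simp add: rate_def)
    qed
    then show ?thesis using that by linarith
  qed
  \<comment> \<open>The upper end of the shell gives ln (1/r) >= (k+1) ln 2 >= (k+1)/2; this 1/2
    doubles the constant 16 of dimension three.\<close>
  have two: "2 ^ Suc (Suc k) * rate 2 k \<le> 32 * (r * ln (1 / r))"
    if r: "1 / 2 ^ Suc (Suc k) < r" "r \<le> 1 / 2 ^ Suc k" for k and r :: real
  proof -
    have r0: "0 < r"
      using r(1) by (rule less_trans[rotated]) simp
    have "(real k + 1) * (1 / 2) \<le> (real k + 1) * ln 2"
      using ln2_ge_two_thirds by (intro mult_left_mono) auto
    also have "\<dots> = ln (2 ^ Suc k)"
      by (simp add: ln_realpow algebra_simps del: power_Suc)
    also have "\<dots> \<le> ln (1 / r)"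
      using r(2) r0 by (intro ln_mono) (auto simp: field_simps)
    finally have ln: "(real k + 1) * (1 / 2) \<le> ln (1 / r)" .
    have "2 ^ Suc (Suc k) * rate 2 k = 32 * (1 / 2 ^ Suc (Suc k) * ((real k + 1) * (1 / 2)))"
    proof -
      have "(4::real) ^ k = 2 ^ k * 2 ^ k" by (simp flip: power_mult_distrib)
      then show ?thesis by (simp add: rate_def field_simps)
    qed
    also have "\<dots> \<le> 32 * (r * ln (1 / r))"
      using r(1) r0 ln by (intro mult_left_mono mult_mono) auto
    finally show ?thesis .
  qed
  show ?thesis
  proof (cases "CARD('n) = 2")
    case True
    then show ?thesis
      using AE_energy_le[OF assms(2), of 2 32 "\<lambda>r. r * ln (1 / r)"] two by simp
  next
    case False
    with assms(1) have "3 \<le> CARD('n)" by simp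
    then show ?thesis
      using AE_energy_le[OF assms(2), of 3 16 "\<lambda>r. r"] three False by simp
  qed
qed

end
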